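(* Let $k\ge 1$ be fixed and let $T$ be a tree with $k$ edges. For every sufficiently large finite set $E\subseteq\mathbb R^2$ with $|E|=n$, the number of distinct $k$-tuples $\vec w\in\mathbb R^k$ for which the weighted tree $T_{\vec w}$ is realized in $E$ is at least $\gtrsim n^{2k/3}$, where the implied constant depends only on $k$ (not on $E$ or $n$).
   Context: Write the vertices of $T$ as $v_1,\dots,v_{k+1}$ and list its $k$ edges in a fixed order $e_1,\dots,e_k$. For $\vec w=(\alpha_1,\dots,\alpha_k)\in\mathbb R^k$, $T_{\vec w}$ denotes $T$ with weight $\alpha_j$ on edge $e_j$. We say $T_{\vec w}$ is realized in $E$ if there is an injective map $\varphi:\{v_1,\dots,v_{k+1}\}\to E$ such that for every $j$, if $e_j=\{v_a,v_b\}$ then $\varphi(v_a)\cdot\varphi(v_b)=\alpha_j$ (standard dot product). That is, $T_{\vec w}$ appears as a subgraph of the complete graph on $E$ whose edges are weighted by dot products. The notation $X\gtrsim Y$ means $X\ge cY$ for some constant $c>0$. *)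

theory Defs
  imports "HOL-Analysis.Analysis"
begin

text \<open>
  A finite simple graph is a vertex set \<open>V\<close> with a set \<open>F\<close> of undirected edges, each edge being
  the two-element set of its endpoints.
\<close>

definition simple_graph :: "'v set \<Rightarrow> 'v set set \<Rightarrow> bool" where
  "simple_graph V F \<longleftrightarrow> finite V \<and> (\<forall>e\<in>F. e \<subseteq> V \<and> card e = 2)"

definition graph_walk :: "'v set set \<Rightarrow> 'v list \<Rightarrow> bool" where
  "graph_walk F p \<longleftrightarrow> p \<noteq> [] \<and> successively (\<lambda>u v. {u, v} \<in> F) p"

definition graph_connected :: "'v set \<Rightarrow> 'v set set \<Rightarrow> bool" where
  "graph_connected V F \<longleftrightarrow>
     V \<noteq> {} \<and> (\<forall>u\<in>V. \<forall>v\<in>V. \<exists>p. graph_walk F p \<and> hd p = u \<and> last p = v)"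

text \<open>A cycle is given by the list of its vertices, the starting vertex not being repeated.\<close>

definition graph_cycle :: "'v set set \<Rightarrow> 'v list \<Rightarrow> bool" where
  "graph_cycle F p \<longleftrightarrow>
     3 \<le> length p \<and> distinct p \<and> graph_walk F p \<and> {last p, hd p} \<in> F"

definition is_tree :: "'v set \<Rightarrow> 'v set set \<Rightarrow> bool" where
  "is_tree V F \<longleftrightarrow>
     simple_graph V F \<and> graph_connected V F \<and> (\<nexists>p. graph_cycle F p)"

text \<open>
  The list \<open>es\<close> is the fixed order of the edges, and a weight vector in \<open>\<real>\<^sup>k\<close> is a list of
  length \<open>k = length es\<close> whose entry \<open>w ! j\<close> is the weight of \<open>es ! j\<close>.
\<close>

definition realized ::
    "'v set \<Rightarrow> 'v set list \<Rightarrow> real list \<Rightarrow> 'a::real_inner set \<Rightarrow> bool" where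
  "realized V es w E \<longleftrightarrow>
     length w = length es \<and>
     (\<exists>\<phi>. inj_on \<phi> V \<and> \<phi> ` V \<subseteq> E \<and>
          (\<forall>j<length es. \<forall>a b. es ! j = {a, b} \<longrightarrow> \<phi> a \<bullet> \<phi> b = w ! j))"

end

theory Submission
  imports Defs
begin

text \<open>
  It suffices to find a nonempty \<open>S \<subseteq> E\<close> such that every \<open>p \<in> S\<close> has at least \<open>c n\<^sup>2\<^sup>/\<^sup>3\<close>
  distinct dot products with points of \<open>S\<close>: growing the tree edge by edge inside \<open>S\<close>, each new
  vertex can be placed so as to realize about \<open>c n\<^sup>2\<^sup>/\<^sup>3\<close> different weights of its edge.

  If a line through the origin contains that many points of \<open>E\<close>, take the points on it. Otherwise
  remove points with few dot products with the remaining ones; were this to go on for \<open>n / 2\<close>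
  steps, the removed points, which have at least of order \<open>n\<^sup>1\<^sup>/\<^sup>3\<close> different directions, would
  cover the remaining ones by few lines in each direction. Joining consecutive points on these
  lines gives a geometric graph with many edges, in which two lines account for at most one
  crossing; this contradicts the crossing inequality, as in Szekely's proof of the
  Szemeredi-Trotter theorem.
\<close>

section \<open>Crossings in geometric graphs\<close>

text \<open>The line through both ends is not cut off at them, so two edges can be compared at every
  abscissa; \<open>spans\<close> restricts to the open edge.\<close>

definition height_on :: "('v \<Rightarrow> real) \<Rightarrow> ('v \<Rightarrow> real) \<Rightarrow> 'v \<times> 'v \<Rightarrow> real \<Rightarrow> real" where
  "height_on X Y e x =
     Y (fst e) + (x - X (fst e)) * ((Y (snd e) - Y (fst e)) / (X (snd e) - X (fst e)))"

definition spans :: "('v \<Rightarrow> real) \<Rightarrow> 'v \<times> 'v \<Rightarrow> real \<Rightarrow> bool" where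
  "spans X e x \<longleftrightarrow> X (fst e) < x \<and> x < X (snd e)"

text \<open>Edges that merely share an end do not cross, while overlapping collinear edges do. A
  nondegenerate edge crosses itself, hence the condition \<open>e \<noteq> e'\<close> wherever
  crossings are counted.\<close>

definition crossing :: "('v \<Rightarrow> real) \<Rightarrow> ('v \<Rightarrow> real) \<Rightarrow> 'v \<times> 'v \<Rightarrow> 'v \<times> 'v \<Rightarrow> bool" where
  "crossing X Y e e' \<longleftrightarrow>
     (\<exists>x. spans X e x \<and> spans X e' x \<and> height_on X Y e x = height_on X Y e' x)"

text \<open>An edge is the pair of its left and right end. Coordinates are functions on abstract
  vertices, so that reflecting the plane negates \<open>X\<close> and shearing it changes only \<open>X\<close>.\<close>

definition geometric_graph ::
    "'v set \<Rightarrow> ('v \<Rightarrow> real) \<Rightarrow> ('v \<Rightarrow> real) \<Rightarrow> ('v \<times> 'v) set \<Rightarrow> bool" where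
  "geometric_graph V X Y G \<longleftrightarrow>
     finite V \<and> inj_on X V \<and> G \<subseteq> V \<times> V \<and>
     (\<forall>e\<in>G. X (fst e) < X (snd e)) \<and>
     (\<forall>e\<in>G. \<forall>v\<in>V. spans X e (X v) \<longrightarrow> height_on X Y e (X v) \<noteq> Y v)"

lemma height_on_fst [simp]: "height_on X Y e (X (fst e)) = Y (fst e)"
  by (simp add: height_on_def)

lemma height_on_snd [simp]:
  "X (fst e) < X (snd e) \<Longrightarrow> height_on X Y e (X (snd e)) = Y (snd e)"
  by (simp add: height_on_def)

lemma height_on_affine: "\<exists>a b. \<forall>x. height_on X Y e x = a + b * x"
proof -
  let ?m = "(Y (snd e) - Y (fst e)) / (X (snd e) - X (fst e))"
  have "\<forall>x. height_on X Y e x = (Y (fst e) - X (fst e) * ?m) + ?m * x"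
    by (simp add: height_on_def left_diff_distrib diff_divide_distrib mult.commute)
  then show ?thesis by blast
qed

lemma heights_meet:
  assumes "height_on X Y e x < height_on X Y e' x" "height_on X Y e' y < height_on X Y e y"
  shows "\<exists>z. min x y < z \<and> z < max x y \<and> height_on X Y e z = height_on X Y e' z"
proof -
  obtain a b where ab: "\<And>x. height_on X Y e x = a + b * x" using height_on_affine by metis
  obtain c d where cd: "\<And>x. height_on X Y e' x = c + d * x" using height_on_affine by metis
  define g where "g z = (a + b * z) - (c + d * z)" for z
  have cont: "continuous_on S g" for S unfolding g_def by (intro continuous_intros)
  have gx: "g x < 0" and gy: "g y > 0" using assms by (auto simp: g_def ab cd)
  consider "x < y" | "y < x" using gx gy by fastforce
  then show ?thesis
  proof cases
    case 1
    obtain z where "x \<le> z" "z \<le> y" "g z = 0" using IVT'[of g x 0 y] 1 gx gy cont by auto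
    moreover have "z \<noteq> x" "z \<noteq> y" using gx gy \<open>g z = 0\<close> by auto
    ultimately show ?thesis using 1 by (intro exI[of _ z]) (auto simp: ab cd g_def)
  next
    case 2
    obtain z where "y \<le> z" "z \<le> x" "g z = 0" using IVT2'[of g x 0 y] 2 gx gy cont by auto
    moreover have "z \<noteq> x" "z \<noteq> y" using gx gy \<open>g z = 0\<close> by auto
    ultimately show ?thesis using 2 by (intro exI[of _ z]) (auto simp: ab cd g_def)
  qed
qed

lemma heights_eq_everywhere:
  assumes "height_on X Y e x = height_on X Y e' x" "height_on X Y e y = height_on X Y e' y" "x \<noteq> y"
  shows "height_on X Y e z = height_on X Y e' z"
proof -
  obtain a b where ab: "\<And>x. height_on X Y e x = a + b * x" using height_on_affine by metis
  obtain c d where cd: "\<And>x. height_on X Y e' x = c + d * x" using height_on_affine by metis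
  have "(b - d) * (x - y) = 0" using assms(1,2) by (simp add: ab cd algebra_simps)
  then have "b = d" using assms(3) by simp
  then show ?thesis using assms(1) by (simp add: ab cd)
qed

text \<open>By the intermediate value theorem a change of order would produce a crossing strictly
  inside both edges. The conclusion is weak because edges may touch at an end.\<close>

lemma order_preserved:
  assumes nc: "\<not> crossing X Y e e'"
    and "X (fst e) \<le> x" "X (fst e') \<le> x" "X (fst e) \<le> y" "X (fst e') \<le> y"
    and "x \<le> X (snd e)" "x \<le> X (snd e')" "y \<le> X (snd e)" "y \<le> X (snd e')"
    and lt: "height_on X Y e x < height_on X Y e' x"
  shows "height_on X Y e y \<le> height_on X Y e' y"
proof (rule ccontr)
  assume "\<not> ?thesis"
  then obtain z where "min x y < z" "z < max x y" "height_on X Y e z = height_on X Y e' z"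
    using heights_meet[OF lt, of y] by (auto simp: not_le)
  with assms show False unfolding crossing_def spans_def by (auto simp: min_def max_def split: if_splits)
qed

lemma geometric_graphD:
  assumes "geometric_graph V X Y G"
  shows "finite V" "inj_on X V" "G \<subseteq> V \<times> V" "e \<in> G \<Longrightarrow> X (fst e) < X (snd e)"
    "e \<in> G \<Longrightarrow> fst e \<in> V" "e \<in> G \<Longrightarrow> snd e \<in> V"
    "e \<in> G \<Longrightarrow> v \<in> V \<Longrightarrow> X (fst e) < X v \<Longrightarrow> X v < X (snd e) \<Longrightarrow> height_on X Y e (X v) \<noteq> Y v"
    "finite G"
proof -
  show "finite G" using assms unfolding geometric_graph_def
    by (meson finite_SigmaI finite_subset)
qed (use assms in \<open>auto simp: geometric_graph_def spans_def\<close>)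

lemma geometric_graph_subset:
  "geometric_graph V X Y G \<Longrightarrow> H \<subseteq> G \<Longrightarrow> W \<subseteq> V \<Longrightarrow> H \<subseteq> W \<times> W \<Longrightarrow> geometric_graph W X Y H"
  unfolding geometric_graph_def by (meson finite_subset inj_on_subset subset_iff)

text \<open>Meeting again to the right of the common end puts both edges on one line. Were their
  right ends different, the nearer one would be a vertex inside the longer edge, which
  \<open>geometric_graph\<close> excludes.\<close>

lemma same_left_end_unique:
  assumes gg: "geometric_graph V X Y G" and "e \<in> G" "e' \<in> G" "fst e = fst e'"
    and "X (fst e) < x" "height_on X Y e x = height_on X Y e' x"
  shows "e = e'"
proof -
  note D = geometric_graphD[OF gg]
  have eq: "height_on X Y e z = height_on X Y e' z" for z
  proof (rule heights_eq_everywhere[of X Y e "X (fst e)" e' x])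
    show "height_on X Y e (X (fst e)) = height_on X Y e' (X (fst e))"
      using height_on_fst[of X Y e] height_on_fst[of X Y e'] assms(4) by simp
  qed (use assms in auto)
  have "X (snd e) = X (snd e')"
  proof (rule ccontr)
    assume "X (snd e) \<noteq> X (snd e')"
    then consider "X (snd e) < X (snd e')" | "X (snd e') < X (snd e)" by linarith
    then show False
    proof cases
      case 1
      then show False using D(7)[of e' "snd e"] D(4)[of e] D(6)[of e] assms eq[of "X (snd e)"] by auto
    next
      case 2
      then show False using D(7)[of e "snd e'"] D(4)[of e'] D(6)[of e'] assms eq[of "X (snd e')"] by auto
    qed
  qed
  then have "snd e = snd e'" using D(2) D(6)[of e] D(6)[of e'] assms by (auto dest: inj_onD)
  then show ?thesis using assms(4) by (simp add: prod_eq_iff)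
qed

section \<open>Reflection and visibility from below\<close>

lemma height_on_reflect:
  assumes "X (fst e) < X (snd e)"
  shows "height_on (\<lambda>v. - X v) Y (prod.swap e) (- x) = height_on X Y e x"
  using assms unfolding height_on_def by (simp add: field_simps)

lemma spans_reflect: "spans (\<lambda>v. - X v) (prod.swap e) (- x) \<longleftrightarrow> spans X e x"
  by (auto simp: spans_def)

text \<open>Negating \<open>X\<close> and swapping the ends exchanges left and right, so facts about
  left ends transfer to right ends.\<close>

lemma geometric_graph_reflect:
  assumes gg: "geometric_graph V X Y G"
  shows "geometric_graph V (\<lambda>v. - X v) Y (prod.swap ` G)"
proof -
  have "inj_on (\<lambda>v. - X v) V" using geometric_graphD(2)[OF gg] by (auto simp: inj_on_def)
  moreover have "prod.swap ` G \<subseteq> V \<times> V" using geometric_graphD(3)[OF gg] by auto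
  ultimately show ?thesis using gg
    by (auto simp: geometric_graph_def spans_reflect height_on_reflect simp del: swap_simp)
qed

lemma crossing_reflect:
  assumes "X (fst e) < X (snd e)" "X (fst e') < X (snd e')"
    and "crossing (\<lambda>v. - X v) Y (prod.swap e) (prod.swap e')"
  shows "crossing X Y e e'"
proof -
  obtain x where "spans (\<lambda>v. - X v) (prod.swap e) x" "spans (\<lambda>v. - X v) (prod.swap e') x"
     "height_on (\<lambda>v. - X v) Y (prod.swap e) x = height_on (\<lambda>v. - X v) Y (prod.swap e') x"
    using assms(3) by (auto simp: crossing_def)
  then show ?thesis
    using spans_reflect[of X e "-x"] spans_reflect[of X e' "-x"]
      height_on_reflect[OF assms(1), of Y "-x"] height_on_reflect[OF assms(2), of Y "-x"]
    unfolding crossing_def by (intro exI[of _ "-x"]) simp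
qed

text \<open>The vertical ray going up from \<open>v\<close> meets \<open>e\<close> first. Without
  crossings no two edges spanning \<open>X v\<close> have the same height there, so \<open>v\<close>
  sees at most one edge; this makes the charging in the planar bound injective.\<close>

definition sees_from_below ::
    "('v \<Rightarrow> real) \<Rightarrow> ('v \<Rightarrow> real) \<Rightarrow> ('v \<times> 'v) set \<Rightarrow> 'v \<Rightarrow> 'v \<times> 'v \<Rightarrow> bool" where
  "sees_from_below X Y G v e \<longleftrightarrow>
     spans X e (X v) \<and> Y v < height_on X Y e (X v) \<and>
     (\<forall>g\<in>G. spans X g (X v) \<longrightarrow> \<not> (Y v < height_on X Y g (X v) \<and>
              height_on X Y g (X v) < height_on X Y e (X v)))"

text \<open>Below \<open>e\<close> and above \<open>a\<close> lies a triangle at their common left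
  end, closed on the right by the vertical line through \<open>snd a\<close>. It contains
  \<open>snd a\<close>, so there is a vertex to choose from, and by \<open>adjacent\<close> no edge
  leaves the common end between \<open>a\<close> and \<open>e\<close>.\<close>

lemma sees_from_below_left_heights:
  assumes gg: "geometric_graph V X Y G"
    and nc: "\<And>e e'. e \<in> G \<Longrightarrow> e' \<in> G \<Longrightarrow> e \<noteq> e' \<Longrightarrow> \<not> crossing X Y e e'"
    and e: "e \<in> G" and a: "a \<in> G" "fst a = fst e" "X (snd a) < X (snd e)"
    and lower: "Y (snd a) < height_on X Y e (X (snd a))"
    and adjacent: "\<And>g z. g \<in> G \<Longrightarrow> fst g = fst e \<Longrightarrow> X (fst e) < z \<Longrightarrow>
        \<not> (height_on X Y a z < height_on X Y g z \<and> height_on X Y g z < height_on X Y e z)"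
  shows "\<exists>v\<in>V. sees_from_below X Y G v e"
proof -
  note D = geometric_graphD[OF gg]
  \<comment> \<open>the vertices in the triangle between \<open>a\<close> and \<open>e\<close>; the leftmost one sees \<open>e\<close>, since an edge
    between them would have its left end in the triangle or start between \<open>a\<close> and \<open>e\<close>\<close>
  define T where "T = {v\<in>V. X (fst e) < X v \<and> X v \<le> X (snd a) \<and>
      height_on X Y a (X v) \<le> Y v \<and> Y v < height_on X Y e (X v)}"
  have ax: "X (fst e) < X (snd a)" using D(4)[OF a(1)] a(2) by simp
  have ahs: "height_on X Y a (X (snd a)) = Y (snd a)" using D(4)[OF a(1)] by simp
  have ahf: "height_on X Y a (X (fst e)) = Y (fst e)" using height_on_fst[of X Y a] a(2) by simp
  have ehf: "height_on X Y e (X (fst e)) = Y (fst e)" by simp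
  have "snd a \<in> T" using D(6)[OF a(1)] ax ahs lower by (simp add: T_def)
  moreover have "finite T" using D(1) by (simp add: T_def)
  ultimately obtain v where v: "v \<in> T" "\<And>u. u \<in> T \<Longrightarrow> X v \<le> X u"
    by (metis arg_min_if_finite(1) arg_min_least empty_iff)
  have vT: "v \<in> V" "X (fst e) < X v" "X v \<le> X (snd a)"
      "height_on X Y a (X v) \<le> Y v" "Y v < height_on X Y e (X v)"
    using v(1) by (auto simp: T_def)
  have "\<not> (Y v < height_on X Y g (X v) \<and> height_on X Y g (X v) < height_on X Y e (X v))"
    if g: "g \<in> G" "spans X g (X v)" for g
  proof
    assume "Y v < height_on X Y g (X v) \<and> height_on X Y g (X v) < height_on X Y e (X v)"
    then have b: "height_on X Y a (X v) < height_on X Y g (X v)"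
       "height_on X Y g (X v) < height_on X Y e (X v)" using vT by auto
    have gr: "X (fst g) < X v" "X v < X (snd g)" using g(2) by (auto simp: spans_def)
    have nge: "\<not> crossing X Y g e" and nag: "\<not> crossing X Y a g"
      using nc[OF g(1) e] nc[OF a(1) g(1)] b by auto
    show False
    proof (cases "X (fst g) > X (fst e)")
      case True
      have 1: "height_on X Y g (X (fst g)) \<le> height_on X Y e (X (fst g))"
        by (rule order_preserved[OF nge, of "X v"]) (use True gr vT a b in auto)
      have 2: "height_on X Y a (X (fst g)) \<le> height_on X Y g (X (fst g))"
        by (rule order_preserved[OF nag, of "X v"]) (use True gr vT a b in auto)
      \<comment> \<open>No vertex lies inside an edge, so the weak bound \<open>1\<close> becomes
        strict, as membership in \<open>T\<close> demands.\<close>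
      have "height_on X Y e (X (fst g)) \<noteq> Y (fst g)"
        by (rule D(7)[OF e D(5)[OF g(1)] True]) (use gr vT a in auto)
      then have "fst g \<in> T" using 1 2 True gr vT D(5)[OF g(1)] by (auto simp: T_def)
      then show False using v(2) gr by fastforce
    next
      case False
      have 1: "height_on X Y g (X (fst e)) \<le> height_on X Y e (X (fst e))"
        by (rule order_preserved[OF nge, of "X v"]) (use False gr vT a b in auto)
      have 2: "height_on X Y a (X (fst e)) \<le> height_on X Y g (X (fst e))"
        by (rule order_preserved[OF nag, of "X v"]) (use False gr vT a b in auto)
      \<comment> \<open>Since \<open>a\<close> and \<open>e\<close> start at the same point,
        \<open>g\<close> is squeezed through it. An edge cannot pass through a vertex, so
        \<open>g\<close> starts there, against \<open>adjacent\<close>.\<close>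
      have on: "height_on X Y g (X (fst e)) = Y (fst e)" using 1 2 ahf ehf by simp
      have "\<not> X (fst g) < X (fst e)" using D(7)[OF g(1) D(5)[OF e]] on gr vT by auto
      then have "fst g = fst e" using False D(2) D(5)[OF g(1)] D(5)[OF e] by (auto dest: inj_onD)
      then show False using adjacent[OF g(1) _ vT(2)] b by auto
    qed
  qed
  then show ?thesis using vT a by (intro bexI[of _ v]) (auto simp: sees_from_below_def spans_def)
qed

lemma sees_from_below_reflect:
  assumes gg: "geometric_graph V X Y G" and e: "e \<in> G"
    and s: "sees_from_below (\<lambda>v. - X v) Y (prod.swap ` G) v (prod.swap e)"
  shows "sees_from_below X Y G v e"
proof -
  have "height_on (\<lambda>v. - X v) Y (prod.swap g) (- X v) = height_on X Y g (X v)" if "g \<in> G" for g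
    using height_on_reflect geometric_graphD(4)[OF gg that] by metis
  then show ?thesis using s e
    unfolding sees_from_below_def by (simp add: spans_reflect del: swap_simp)
qed

section \<open>Slopes at a common end and the planar edge bound\<close>

definition slope :: "('v \<Rightarrow> real) \<Rightarrow> ('v \<Rightarrow> real) \<Rightarrow> 'v \<times> 'v \<Rightarrow> real" where
  "slope X Y e = (Y (snd e) - Y (fst e)) / (X (snd e) - X (fst e))"

lemma height_on_slope_fst: "height_on X Y e x = Y (fst e) + (x - X (fst e)) * slope X Y e"
  by (simp add: height_on_def slope_def)

lemma height_on_slope_snd:
  "X (fst e) < X (snd e) \<Longrightarrow> height_on X Y e x = Y (snd e) + (x - X (snd e)) * slope X Y e"
  by (simp add: height_on_def slope_def field_simps)

lemma slope_reflect:
  "X (fst e) < X (snd e) \<Longrightarrow> slope (\<lambda>v. - X v) Y (prod.swap e) = - slope X Y e"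
  by (simp add: slope_def field_simps)

lemma same_right_end_unique:
  assumes gg: "geometric_graph V X Y G" and e: "e \<in> G" "e' \<in> G" "snd e = snd e'"
    and x: "x < X (snd e)" "height_on X Y e x = height_on X Y e' x"
  shows "e = e'"
proof -
  note D = geometric_graphD[OF gg]
  have "prod.swap e = prod.swap e'"
  proof (rule same_left_end_unique[OF geometric_graph_reflect[OF gg]])
    show "height_on (\<lambda>v. - X v) Y (prod.swap e) (- x) = height_on (\<lambda>v. - X v) Y (prod.swap e') (- x)"
      using x(2) height_on_reflect[OF D(4)[OF e(1)]] height_on_reflect[OF D(4)[OF e(2)]] by simp
  qed (use e x in auto)
  then show ?thesis by (metis swap_swap)
qed

text \<open>To the right of a common left end heights are ordered like slopes, so the neighbour in
  slope is the edge immediately below.\<close>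

lemma sees_from_below_left:
  assumes gg: "geometric_graph V X Y G"
    and nc: "\<And>e e'. e \<in> G \<Longrightarrow> e' \<in> G \<Longrightarrow> e \<noteq> e' \<Longrightarrow> \<not> crossing X Y e e'"
    and e: "e \<in> G" and a: "a \<in> G" "fst a = fst e" "X (snd a) < X (snd e)"
    and lower: "slope X Y a < slope X Y e"
    and adjacent: "\<And>g. g \<in> G \<Longrightarrow> fst g = fst e \<Longrightarrow>
        \<not> (slope X Y a < slope X Y g \<and> slope X Y g < slope X Y e)"
  shows "\<exists>v\<in>V. sees_from_below X Y G v e"
proof (rule sees_from_below_left_heights[OF gg nc e a])
  note D = geometric_graphD[OF gg]
  have "height_on X Y a (X (snd a)) < height_on X Y e (X (snd a))"
    unfolding height_on_slope_fst using D(4)[OF a(1)] a(2) lower by simp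
  then show "Y (snd a) < height_on X Y e (X (snd a))" using D(4)[OF a(1)] by simp
next
  fix g z assume "g \<in> G" "fst g = fst e" "X (fst e) < z"
  then show "\<not> (height_on X Y a z < height_on X Y g z \<and> height_on X Y g z < height_on X Y e z)"
    using adjacent[of g] a(2) unfolding height_on_slope_fst by auto
qed auto

text \<open>This serves the edges that are lowest at neither end. If the next lower edge at one end
  stops short of the other end of \<open>e\<close>, the triangle argument applies, reflected if
  necessary. If both next lower edges reach across, they would cross each other.\<close>

lemma exists_sees_from_below:
  assumes gg: "geometric_graph V X Y G"
    and nc: "\<And>e e'. e \<in> G \<Longrightarrow> e' \<in> G \<Longrightarrow> e \<noteq> e' \<Longrightarrow> \<not> crossing X Y e e'"
    and e: "e \<in> G"
    and a0: "a0 \<in> G" "fst a0 = fst e" "slope X Y a0 < slope X Y e"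
    and b0: "b0 \<in> G" "snd b0 = snd e" "slope X Y e < slope X Y b0"
  shows "\<exists>v\<in>V. sees_from_below X Y G v e"
proof -
  note D = geometric_graphD[OF gg]
  let ?A = "{g\<in>G. fst g = fst e \<and> slope X Y g < slope X Y e}"
  let ?B = "{g\<in>G. snd g = snd e \<and> slope X Y e < slope X Y g}"
  have fin: "finite ?A" "finite ?B" using D(8) by auto
  have "?A \<noteq> {}" "?B \<noteq> {}" using a0 b0 by blast+
  \<comment> \<open>\<open>a\<close> is the next lower edge at the left end, \<open>b\<close> the
    one at the right end, where a lower edge has the larger slope.\<close>
  obtain a where a: "a \<in> ?A" "\<And>g. g \<in> ?A \<Longrightarrow> slope X Y g \<le> slope X Y a"
    using arg_min_if_finite(1)[OF fin(1) \<open>?A \<noteq> {}\<close>, of "\<lambda>g. - slope X Y g"]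
      arg_min_least[OF fin(1) \<open>?A \<noteq> {}\<close>, of _ "\<lambda>g. - slope X Y g"] by (meson neg_le_iff_le)
  obtain b where b: "b \<in> ?B" "\<And>g. g \<in> ?B \<Longrightarrow> slope X Y b \<le> slope X Y g"
    using arg_min_if_finite(1)[OF fin(2) \<open>?B \<noteq> {}\<close>, of "slope X Y"]
      arg_min_least[OF fin(2) \<open>?B \<noteq> {}\<close>, of _ "slope X Y"] by meson
  have aG: "a \<in> G" "fst a = fst e" "slope X Y a < slope X Y e" using a by auto
  have bG: "b \<in> G" "snd b = snd e" "slope X Y e < slope X Y b" using b by auto
  consider "X (snd a) < X (snd e)" | "X (fst e) < X (fst b)"
    | "X (snd e) \<le> X (snd a)" "X (fst b) \<le> X (fst e)" by linarith
  then show ?thesis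
  proof cases
    case 1
    show ?thesis
    proof (rule sees_from_below_left[OF gg nc e aG(1,2) 1 aG(3)])
      fix g assume "g \<in> G" "fst g = fst e"
      then show "\<not> (slope X Y a < slope X Y g \<and> slope X Y g < slope X Y e)"
        using a(2)[of g] by auto
    qed
  next
    case 2
    let ?X = "\<lambda>v. - X v"
    have sl: "slope ?X Y (prod.swap g) = - slope X Y g" if "g \<in> G" for g
      using slope_reflect[of X g Y] D(4)[OF that] by simp
    have "\<exists>v\<in>V. sees_from_below ?X Y (prod.swap ` G) v (prod.swap e)"
    proof (rule sees_from_below_left[OF geometric_graph_reflect[OF gg], where a = "prod.swap b"])
      fix g g' assume g: "g \<in> prod.swap ` G" "g' \<in> prod.swap ` G" "g \<noteq> g'"
      then obtain h h' where h: "g = prod.swap h" "h \<in> G" "g' = prod.swap h'" "h' \<in> G" by blast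
      show "\<not> crossing ?X Y g g'"
        using crossing_reflect[OF D(4)[OF h(2)] D(4)[OF h(4)]] nc[OF h(2,4)] g(3) h by auto
    next
      fix g assume "g \<in> prod.swap ` G" "fst g = fst (prod.swap e)"
      then obtain h where h: "g = prod.swap h" "h \<in> G" "snd h = snd e" by auto
      show "\<not> (slope ?X Y (prod.swap b) < slope ?X Y g \<and> slope ?X Y g < slope ?X Y (prod.swap e))"
        using b(2)[of h] h sl[OF h(2)] sl[OF bG(1)] sl[OF e] by auto
    qed (use e 2 bG sl[OF bG(1)] sl[OF e] in auto)
    then show ?thesis using sees_from_below_reflect[OF gg e] by blast
  next
    case 3
    have lt: "X (fst e) < X (snd e)" using D(4)[OF e] .
    \<comment> \<open>Over the left end of \<open>e\<close> the edge \<open>b\<close> is below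
      \<open>a\<close>, over the right end it is above, which contradicts the preserved
      order.\<close>
    have 4: "height_on X Y b (X (fst e)) < height_on X Y e (X (fst e))"
      unfolding height_on_slope_snd[OF D(4)[OF bG(1)]] height_on_slope_snd[OF lt] bG(2)
      using mult_strict_left_mono_neg[OF bG(3), of "X (fst e) - X (snd e)"] lt by simp
    have 5: "height_on X Y a (X (snd e)) < height_on X Y e (X (snd e))"
      unfolding height_on_slope_fst aG(2)
      using mult_strict_left_mono[OF aG(3), of "X (snd e) - X (fst e)"] lt by simp
    have 6: "height_on X Y a (X (fst e)) = height_on X Y e (X (fst e))"
      using height_on_fst[of X Y a] aG by simp
    have 7: "height_on X Y b (X (snd e)) = height_on X Y e (X (snd e))"
      using height_on_snd[of X b Y] height_on_snd[of X e Y] bG D(4)[OF bG(1)] lt by simp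
    have "b \<noteq> a" using 4 6 by auto
    have "height_on X Y b (X (snd e)) \<le> height_on X Y a (X (snd e))"
      by (rule order_preserved[OF nc[OF bG(1) aG(1) \<open>b \<noteq> a\<close>], of "X (fst e)"])
        (use 3 4 6 lt aG bG in auto)
    then show ?thesis using 5 7 by simp
  qed
qed

text \<open>Each edge is charged to its left end if it is the lowest edge there, to its right end if it
  is the lowest edge there, and otherwise to a vertex that sees it from below.\<close>

lemma planar_edge_bound:
  assumes gg: "geometric_graph V X Y G"
    and nc: "\<And>e e'. e \<in> G \<Longrightarrow> e' \<in> G \<Longrightarrow> e \<noteq> e' \<Longrightarrow> \<not> crossing X Y e e'"
  shows "card G \<le> 3 * card V"
proof -
  note D = geometric_graphD[OF gg]
  define G1 where "G1 = {e\<in>G. \<forall>g\<in>G. fst g = fst e \<longrightarrow> slope X Y e \<le> slope X Y g}"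
  \<comment> \<open>At a right end the lowest edge has the largest slope, so the inequality is
    reversed.\<close>
  define G2 where "G2 = {e\<in>G. \<forall>g\<in>G. snd g = snd e \<longrightarrow> slope X Y g \<le> slope X Y e}"
  define G3 where "G3 = G - (G1 \<union> G2)"
  have "inj_on fst G1"
  proof (rule inj_onI)
    fix e e' assume h: "e \<in> G1" "e' \<in> G1" "fst e = fst e'"
    then have eG: "e \<in> G" "e' \<in> G" and "slope X Y e = slope X Y e'"
      unfolding G1_def by (auto intro!: antisym)
    then show "e = e'" using same_left_end_unique[OF gg eG h(3), of "X (snd e)"] D(4)[OF eG(1)] h(3)
      by (simp only: height_on_slope_fst)
  qed
  moreover have "fst ` G1 \<subseteq> V" using D(5) by (auto simp: G1_def)
  ultimately have c1: "card G1 \<le> card V" using D(1) card_inj_on_le by blast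
  have "inj_on snd G2"
  proof (rule inj_onI)
    fix e e' assume h: "e \<in> G2" "e' \<in> G2" "snd e = snd e'"
    then have eG: "e \<in> G" "e' \<in> G" and "slope X Y e = slope X Y e'"
      unfolding G2_def by (auto intro!: antisym)
    then show "e = e'" using same_right_end_unique[OF gg eG h(3), of "X (fst e)"] D(4)[OF eG(1)] h(3)
        height_on_slope_snd[OF D(4)[OF eG(1)], of Y "X (fst e)"]
        height_on_slope_snd[OF D(4)[OF eG(2)], of Y "X (fst e)"] by metis
  qed
  moreover have "snd ` G2 \<subseteq> V" using D(6) by (auto simp: G2_def)
  ultimately have c2: "card G2 \<le> card V" using D(1) card_inj_on_le by blast
  have "\<exists>v\<in>V. sees_from_below X Y G v e" if "e \<in> G3" for e
  proof -
    have e: "e \<in> G" "e \<notin> G1" "e \<notin> G2" using that by (simp_all add: G3_def)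
    obtain a where "a \<in> G" "fst a = fst e" "slope X Y a < slope X Y e"
      using e(1,2) unfolding G1_def mem_Collect_eq not_le[symmetric] by blast
    moreover obtain b where "b \<in> G" "snd b = snd e" "slope X Y e < slope X Y b"
      using e(1,3) unfolding G2_def mem_Collect_eq not_le[symmetric] by blast
    ultimately show ?thesis using exists_sees_from_below[OF gg nc e(1)] by blast
  qed
  then obtain f where f: "\<And>e. e \<in> G3 \<Longrightarrow> f e \<in> V \<and> sees_from_below X Y G (f e) e" by metis
  have "inj_on f G3"
  proof (rule inj_onI)
    fix e e' assume h: "e \<in> G3" "e' \<in> G3" "f e = f e'"
    have eG: "e \<in> G" "e' \<in> G" using h by (auto simp: G3_def)
    have s: "sees_from_below X Y G (f e) e" "sees_from_below X Y G (f e) e'"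
      using f[OF h(1)] f[OF h(2)] h(3) by auto
    \<comment> \<open>Of two edges strictly above the same vertex and both seen from it, neither is
      lower; hence they meet over that vertex.\<close>
    then have "height_on X Y e (X (f e)) = height_on X Y e' (X (f e))"
      unfolding sees_from_below_def using eG by (meson linorder_neqE_linordered_idom)
    then have "crossing X Y e e'" using s unfolding crossing_def sees_from_below_def by blast
    then show "e = e'" using nc[OF eG] by blast
  qed
  moreover have "f ` G3 \<subseteq> V" using f by auto
  ultimately have c3: "card G3 \<le> card V" using D(1) card_inj_on_le by blast
  have "G = (G1 \<union> G2) \<union> G3" unfolding G3_def G1_def G2_def by auto
  then have "card G = card ((G1 \<union> G2) \<union> G3)" by (rule arg_cong)
  then have "card G \<le> card G1 + card G2 + card G3"
    using card_Un_le[of "G1 \<union> G2" G3] card_Un_le[of G1 G2] by linarith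
  then show ?thesis using c1 c2 c3 by simp
qed

section \<open>The crossing inequality by random sampling\<close>

text \<open>Deleting the first edge of every crossing pair leaves a graph to which the planar bound
  applies. Pairs are ordered, so every crossing is counted twice; this costs only a constant
  factor.\<close>

lemma edges_le_crossings:
  assumes gg: "geometric_graph V X Y G"
  shows "card G \<le> 3 * card V + card {(e, e'). e \<in> G \<and> e' \<in> G \<and> e \<noteq> e' \<and> crossing X Y e e'}"
    (is "_ \<le> _ + card ?C")
proof -
  note D = geometric_graphD[OF gg]
  have "?C \<subseteq> G \<times> G" by auto
  then have fin: "finite ?C" using D(8) by (meson finite_SigmaI finite_subset)
  let ?H = "G - fst ` ?C"
  have "geometric_graph V X Y ?H"
    by (rule geometric_graph_subset[OF gg]) (use D(3) in auto)
  then have "card ?H \<le> 3 * card V"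
  proof (rule planar_edge_bound)
    fix e e' assume "e \<in> ?H" "e' \<in> ?H" "e \<noteq> e'"
    then show "\<not> crossing X Y e e'" by force
  qed
  moreover have "card (fst ` ?C) \<le> card ?C" using fin by (rule card_image_le)
  moreover have "card G \<le> card ?H + card (fst ` ?C)"
    using card_Un_le[of ?H "fst ` ?C"] D(8) fin
    by (meson diff_card_le_card_Diff finite_imageI le_diff_conv order_trans)
  ultimately show ?thesis by linarith
qed

text \<open>A crossing must involve four vertices in order to survive sampling with probability
  \<open>1 / K ^ 4\<close>.\<close>

lemma crossing_distinct_ends:
  assumes gg: "geometric_graph V X Y G" and e: "e \<in> G" "e' \<in> G" "e \<noteq> e'" and c: "crossing X Y e e'"
  shows "card {fst e, snd e, fst e', snd e'} = 4"
proof -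
  note D = geometric_graphD[OF gg]
  obtain x where x: "spans X e x" "spans X e' x" "height_on X Y e x = height_on X Y e' x"
    using c by (auto simp: crossing_def)
  have "fst e \<noteq> fst e'" using same_left_end_unique[OF gg e(1,2)] x e(3) by (auto simp: spans_def)
  moreover have "snd e \<noteq> snd e'" using same_right_end_unique[OF gg e(1,2)] x e(3) by (auto simp: spans_def)
  moreover have "fst e \<noteq> snd e" "fst e' \<noteq> snd e'" "fst e \<noteq> snd e'" "fst e' \<noteq> snd e"
    using x by (auto simp: spans_def)
  ultimately show ?thesis by simp
qed

text \<open>All of \<open>W\<close> is sampled with probability \<open>1 / K ^ card W\<close>; the
  denominators are cleared so that only counting is involved.\<close>

lemma card_functions_vanishing:
  assumes "finite V" "W \<subseteq> V" "K > 0"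
  shows "real (card {f \<in> V \<rightarrow>\<^sub>E {..<K}. \<forall>v\<in>W. f v = (0::nat)}) * real K ^ card W = real K ^ card V"
proof -
  have "{f \<in> V \<rightarrow>\<^sub>E {..<K}. \<forall>v\<in>W. f v = 0} = (\<Pi>\<^sub>E v\<in>V. if v \<in> W then {0} else {..<K})"
    using assms by (auto simp: PiE_iff extensional_def split: if_splits)
  also have "card \<dots> = (\<Prod>v\<in>V. if v \<in> W then 1 else K)"
    using assms(1) by (simp add: card_PiE if_distrib cong: if_cong)
  also have "\<dots> = K ^ card (V - W)"
    using assms(1) by (simp add: prod.If_cases Diff_eq)
  finally have "card {f \<in> V \<rightarrow>\<^sub>E {..<K}. \<forall>v\<in>W. f v = 0} * K ^ card W = K ^ (card (V - W) + card W)"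
    by (simp add: power_add)
  also have "card (V - W) + card W = card V"
    using assms by (metis card_Diff_subset card_mono finite_subset le_add_diff_inverse2)
  finally have "real (card {f \<in> V \<rightarrow>\<^sub>E {..<K}. \<forall>v\<in>W. f v = 0} * K ^ card W) = real (K ^ card V)"
    by (rule arg_cong)
  then show ?thesis by (simp only: of_nat_mult of_nat_power)
qed

text \<open>The zero set of a uniform \<open>f\<close> is a random vertex set of density \<open>1 / K\<close>.\<close>

lemma sum_card_sampled:
  fixes supp :: "'c \<Rightarrow> 'v set"
  assumes "finite V" "finite C" "K > 0" "\<And>c. c \<in> C \<Longrightarrow> supp c \<subseteq> V \<and> card (supp c) = m"
  shows "(\<Sum>f \<in> V \<rightarrow>\<^sub>E {..<K}. real (card {c\<in>C. \<forall>v\<in>supp c. f v = (0::nat)})) * real K ^ m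
    = real (card C) * real K ^ card V"
proof -
  let ?F = "V \<rightarrow>\<^sub>E {..<K}"
  have finF: "finite ?F" using assms(1) by (simp add: finite_PiE)
  have "(\<Sum>f \<in> ?F. real (card {c\<in>C. \<forall>v\<in>supp c. f v = 0})) =
      (\<Sum>f\<in>?F. \<Sum>c\<in>C. if \<forall>v\<in>supp c. f v = 0 then 1 else 0)"
    using assms(2) by (simp add: sum.If_cases Int_def)
  also have "\<dots> = (\<Sum>c\<in>C. \<Sum>f\<in>?F. if \<forall>v\<in>supp c. f v = 0 then 1 else 0)"
    by (rule sum.swap)
  also have "\<dots> = (\<Sum>c\<in>C. real (card {f\<in>?F. \<forall>v\<in>supp c. f v = 0}))"
    using finF by (simp add: sum.If_cases Int_def)
  finally have "(\<Sum>f \<in> ?F. real (card {c\<in>C. \<forall>v\<in>supp c. f v = 0})) * real K ^ m =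
     (\<Sum>c\<in>C. real (card {f\<in>?F. \<forall>v\<in>supp c. f v = 0}) * real K ^ m)"
    by (simp add: sum_distrib_right)
  also have "\<dots> = (\<Sum>c\<in>C. real K ^ card V)"
  proof (rule sum.cong)
    fix c assume "c \<in> C"
    then show "real (card {f\<in>?F. \<forall>v\<in>supp c. f v = 0}) * real K ^ m = real K ^ card V"
      using card_functions_vanishing[of V "supp c" K] assms by auto
  qed simp
  finally show ?thesis by simp
qed

text \<open>Average \<open>edges_le_crossings\<close> over the subgraphs induced by random vertex
  sets of density \<open>1 / K\<close>: vertices, edges and crossings survive with probability
  \<open>1 / K\<close>, \<open>1 / K ^ 2\<close> and \<open>1 / K ^ 4\<close>. The parameter stays
  free and is chosen in the application.\<close>

lemma crossing_inequality:
  assumes gg: "geometric_graph V X Y G" and K: "K > 0"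
  shows "real (card G) * real K ^ 2 \<le> 3 * real (card V) * real K ^ 3 +
    real (card {(e, e'). e \<in> G \<and> e' \<in> G \<and> e \<noteq> e' \<and> crossing X Y e e'})"
    (is "_ \<le> _ + real (card ?C)")
proof -
  note D = geometric_graphD[OF gg]
  have "?C \<subseteq> G \<times> G" by auto
  then have finC: "finite ?C" using D(8) by (meson finite_SigmaI finite_subset)
  let ?F = "V \<rightarrow>\<^sub>E {..<K}"
  \<comment> \<open>The three sets are written with explicit supports of size 1, 2 and 4 so that
    \<open>sum_card_sampled\<close> matches them, even for the singleton.\<close>
  define SV where "SV f = {v\<in>V. \<forall>u\<in>{v}. f u = (0::nat)}" for f
  define SG where "SG f = {e\<in>G. \<forall>u\<in>{fst e, snd e}. f u = (0::nat)}" for f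
  define SC where "SC f = {c\<in>?C. \<forall>u\<in>{fst (fst c), snd (fst c), fst (snd c), snd (snd c)}. f u = (0::nat)}" for f
  have each: "real (card (SG f)) \<le> 3 * real (card (SV f)) + real (card (SC f))" for f
  proof -
    have "geometric_graph (SV f) X Y (SG f)"
      by (rule geometric_graph_subset[OF gg]) (use D(5,6) in \<open>auto simp: SG_def SV_def\<close>)
    from edges_le_crossings[OF this]
    have "card (SG f) \<le> 3 * card (SV f) +
       card {(e, e'). e \<in> SG f \<and> e' \<in> SG f \<and> e \<noteq> e' \<and> crossing X Y e e'}" .
    also have "{(e, e'). e \<in> SG f \<and> e' \<in> SG f \<and> e \<noteq> e' \<and> crossing X Y e e'} = SC f"
      by (auto simp: SG_def SC_def)
    finally show ?thesis by linarith
  qed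
  have 1: "(\<Sum>f\<in>?F. real (card (SV f))) * real K ^ 1 = real (card V) * real K ^ card V"
    unfolding SV_def by (rule sum_card_sampled) (use D(1) K in auto)
  have 2: "(\<Sum>f\<in>?F. real (card (SG f))) * real K ^ 2 = real (card G) * real K ^ card V"
    unfolding SG_def
  proof (rule sum_card_sampled)
    fix e assume "e \<in> G"
    then show "{fst e, snd e} \<subseteq> V \<and> card {fst e, snd e} = 2"
      using D(4,5,6)[of e] by (simp add: card_2_iff) force
  qed (use D K in auto)
  have 3: "(\<Sum>f\<in>?F. real (card (SC f))) * real K ^ 4 = real (card ?C) * real K ^ card V"
    unfolding SC_def
  proof (rule sum_card_sampled)
    fix c assume c: "c \<in> ?C"
    then have "fst c \<in> G" "snd c \<in> G" "fst c \<noteq> snd c" "crossing X Y (fst c) (snd c)"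
      by auto
    then show "{fst (fst c), snd (fst c), fst (snd c), snd (snd c)} \<subseteq> V \<and>
       card {fst (fst c), snd (fst c), fst (snd c), snd (snd c)} = 4"
      using crossing_distinct_ends[OF gg, of "fst c" "snd c"] D(5,6) by simp
  qed (use D(1) finC K in auto)
  have "(\<Sum>f\<in>?F. real (card (SG f))) \<le>
     3 * (\<Sum>f\<in>?F. real (card (SV f))) + (\<Sum>f\<in>?F. real (card (SC f)))"
    using sum_mono[of ?F, OF each] by (simp add: sum.distrib sum_distrib_left)
  then have le: "(\<Sum>f\<in>?F. real (card (SG f))) * real K ^ 4 \<le>
     (3 * (\<Sum>f\<in>?F. real (card (SV f))) + (\<Sum>f\<in>?F. real (card (SC f)))) * real K ^ 4"
    by (rule mult_right_mono) simp
  \<comment> \<open>Here \<open>M\<close> stands for the number \<open>K ^ card V\<close> of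
    functions, a positive factor that cancels at the end.\<close>
  have rearrange: "g * k ^ 2 * M \<le> (3 * n * k ^ 3 + c) * M"
    if "s2 * k ^ 4 \<le> (3 * s1 + s3) * k ^ 4" "s1 * k ^ 1 = n * M" "s2 * k ^ 2 = g * M" "s3 * k ^ 4 = c * M"
    for s1 s2 s3 k M n g c :: real
  proof -
    have "g * k ^ 2 * M = (s2 * k ^ 2) * k ^ 2" using that(3) by (simp only: mult_ac)
    also have "\<dots> = s2 * k ^ 4" by algebra
    also have "\<dots> \<le> (3 * s1 + s3) * k ^ 4" by (rule that(1))
    also have "\<dots> = 3 * (s1 * k ^ 1) * k ^ 3 + s3 * k ^ 4" by algebra
    also have "\<dots> = (3 * n * k ^ 3 + c) * M" unfolding that(2,4) by algebra
    finally show ?thesis .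
  qed
  show ?thesis
    using rearrange[OF le 1 2 3] K by simp
qed

section \<open>Projections in many directions\<close>

text \<open>The intercept \<open>Y p - m * X p\<close> names the line of slope \<open>m\<close>
  through \<open>p\<close>. Joining only neighbours on a line keeps points of \<open>P\<close> out
  of the interior of edges.\<close>

definition consecutive ::
    "'v set \<Rightarrow> ('v \<Rightarrow> real) \<Rightarrow> ('v \<Rightarrow> real) \<Rightarrow> real \<Rightarrow> ('v \<times> 'v) set" where
  "consecutive P X Y m = {(p, q). p \<in> P \<and> q \<in> P \<and> X p < X q \<and> Y p - m * X p = Y q - m * X q \<and>
     (\<forall>r\<in>P. X p < X r \<longrightarrow> X r < X q \<longrightarrow> Y r - m * X r \<noteq> Y p - m * X p)}"

lemma consecutive_slope: "e \<in> consecutive P X Y m \<Longrightarrow> slope X Y e = m"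
  by (auto simp: consecutive_def slope_def field_simps)

lemma height_on_consecutive:
  "e \<in> consecutive P X Y m \<Longrightarrow> height_on X Y e x = m * x + (Y (fst e) - m * X (fst e))"
  by (simp add: height_on_slope_fst consecutive_slope algebra_simps)

text \<open>Both edges lie on one line and overlap; if they differed, an end of one would be a point
  of \<open>P\<close> inside the other.\<close>

lemma consecutive_unique:
  assumes inj: "inj_on X P" and e: "e \<in> consecutive P X Y m" "e' \<in> consecutive P X Y m"
    and x: "spans X e x" "spans X e' x" "height_on X Y e x = height_on X Y e' x"
  shows "e = e'"
proof -
  have i: "Y (fst e) - m * X (fst e) = Y (fst e') - m * X (fst e')"
    using x(3) by (simp add: height_on_consecutive[OF e(1)] height_on_consecutive[OF e(2)])
  have D: "fst a \<in> P" "snd a \<in> P" "X (fst a) < X (snd a)"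
      "Y (snd a) - m * X (snd a) = Y (fst a) - m * X (fst a)"
      "\<And>r. r \<in> P \<Longrightarrow> X (fst a) < X r \<Longrightarrow> X r < X (snd a) \<Longrightarrow> Y r - m * X r \<noteq> Y (fst a) - m * X (fst a)"
      if "a \<in> consecutive P X Y m" for a using that by (auto simp: consecutive_def)
  have o: "X (fst e) < x" "x < X (snd e)" "X (fst e') < x" "x < X (snd e')"
    using x by (auto simp: spans_def)
  have "\<not> X (fst e) < X (fst e')" "\<not> X (fst e') < X (fst e)"
    using D(5)[OF e(1) D(1)[OF e(2)]] D(5)[OF e(2) D(1)[OF e(1)]] i o by auto
  then have 1: "fst e = fst e'" using inj D(1)[OF e(1)] D(1)[OF e(2)] by (auto dest: inj_onD)
  have "\<not> X (snd e) < X (snd e')" "\<not> X (snd e') < X (snd e)"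
    using D(5)[OF e(1) D(2)[OF e(2)]] D(5)[OF e(2) D(2)[OF e(1)]] i o
      D(4)[OF e(1)] D(4)[OF e(2)] by auto
  then have "snd e = snd e'" using inj D(2)[OF e(1)] D(2)[OF e(2)] by (auto dest: inj_onD)
  with 1 show ?thesis by (simp add: prod_eq_iff)
qed

lemma finite_consecutive: "finite P \<Longrightarrow> finite (consecutive P X Y m)"
  by (rule finite_subset[of _ "P \<times> P"]) (auto simp: consecutive_def)

text \<open>Every point except the rightmost on its line is the left end of an edge, and the
  exceptions number at most one per intercept.\<close>

lemma card_consecutive:
  assumes fin: "finite P" and inj: "inj_on X P"
  shows "card P \<le> card (consecutive P X Y m) + card ((\<lambda>p. Y p - m * X p) ` P)"
proof -
  let ?c = "\<lambda>p. Y p - m * X p" and ?G = "consecutive P X Y m"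
  have succ: "p \<in> fst ` ?G" if p: "p \<in> P" "p' \<in> P" "?c p = ?c p'" "X p < X p'" for p p'
  proof -
    let ?S = "{q\<in>P. X p < X q \<and> ?c q = ?c p}"
    have S: "finite ?S" "?S \<noteq> {}" using fin p by auto
    define q where "q = arg_min_on X ?S"
    have q: "q \<in> ?S" unfolding q_def by (rule arg_min_if_finite(1)[OF S])
    have "X q \<le> X r" if "r \<in> ?S" for r unfolding q_def by (rule arg_min_least[OF S that])
    then have "(p, q) \<in> ?G" using q p by (force simp: consecutive_def)
    then show ?thesis by force
  qed
  have "inj_on ?c (P - fst ` ?G)"
  proof (rule inj_onI)
    fix p p' assume h: "p \<in> P - fst ` ?G" "p' \<in> P - fst ` ?G" "?c p = ?c p'"
    then have "\<not> X p < X p'" "\<not> X p' < X p" using succ[of p p'] succ[of p' p] by auto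
    then show "p = p'" using inj h by (auto dest: inj_onD)
  qed
  then have "card (P - fst ` ?G) \<le> card (?c ` P)"
    by (rule card_inj_on_le) (use fin in auto)
  moreover have "card (fst ` ?G) \<le> card ?G" by (rule card_image_le[OF finite_consecutive[OF fin]])
  moreover have "card P \<le> card (P - fst ` ?G) + card (fst ` ?G)"
    using card_Un_le[of "P - fst ` ?G" "fst ` ?G"] fin finite_consecutive[OF fin]
    by (meson diff_card_le_card_Diff finite_imageI le_diff_conv order_trans)
  ultimately show ?thesis by linarith
qed

text \<open>The neighbours in all directions of \<open>A\<close> give at least
  \<open>card A * (card P - t)\<close> edges on at most \<open>card A * t\<close> lines. Crossings
  inject into pairs of lines, and the crossing inequality compares the two counts.\<close>

lemma projection_inequality:
  fixes X Y :: "'v \<Rightarrow> real"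
  assumes fin: "finite P" and inj: "inj_on X P" and finA: "finite A" and K: "K > 0"
    and t: "\<And>m. m \<in> A \<Longrightarrow> card ((\<lambda>p. Y p - m * X p) ` P) \<le> t"
  shows "real (card A) * (real (card P) - real t) * real K ^ 2
     \<le> 3 * real (card P) * real K ^ 3 + (real (card A) * real t) ^ 2"
proof -
  let ?c = "\<lambda>m p. Y p - m * X p"
  define G where "G = (\<Union>m\<in>A. consecutive P X Y m)"
  have Gslope: "slope X Y e \<in> A \<and> e \<in> consecutive P X Y (slope X Y e)" if e: "e \<in> G" for e
  proof -
    obtain m where "m \<in> A" "e \<in> consecutive P X Y m" using e by (auto simp: G_def)
    then show ?thesis using consecutive_slope by metis
  qed
  have gg: "geometric_graph P X Y G"
    unfolding geometric_graph_def
  proof (intro conjI ballI impI)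
    show "G \<subseteq> P \<times> P" by (auto simp: G_def consecutive_def)
    fix e assume e: "e \<in> G"
    then obtain m where m: "e \<in> consecutive P X Y m" by (auto simp: G_def)
    then show "X (fst e) < X (snd e)" by (auto simp: consecutive_def)
    fix v assume v: "v \<in> P" "spans X e (X v)"
    then have "?c m v \<noteq> ?c m (fst e)" using m by (auto simp: consecutive_def spans_def)
    then show "height_on X Y e (X v) \<noteq> Y v" by (simp add: height_on_consecutive[OF m])
  qed (use fin inj in auto)
  have disj: "consecutive P X Y m \<inter> consecutive P X Y m' = {}" if "m \<noteq> m'" for m m'
    using that consecutive_slope by (metis disjoint_iff)
  have "card G = (\<Sum>m\<in>A. card (consecutive P X Y m))"
    unfolding G_def by (rule card_UN_disjoint[OF finA]) (simp_all add: finite_consecutive[OF fin] disj)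
  then have "real (card G) = (\<Sum>m\<in>A. real (card (consecutive P X Y m)))" by simp
  also have "\<dots> \<ge> (\<Sum>m\<in>A. real (card P) - real t)"
  proof (rule sum_mono)
    fix m assume "m \<in> A"
    then show "real (card P) - real t \<le> real (card (consecutive P X Y m))"
      using card_consecutive[OF fin inj, of Y m] t[of m] by linarith
  qed
  finally have edges: "real (card A) * (real (card P) - real t) \<le> real (card G)" by simp
  let ?C = "{(e, e'). e \<in> G \<and> e' \<in> G \<and> e \<noteq> e' \<and> crossing X Y e e'}"
  define line where "line e = (slope X Y e, ?c (slope X Y e) (fst e))" for e
  define L where "L = (SIGMA m:A. ?c m ` P)"
  have finL: "finite L" unfolding L_def using finA fin by auto
  have "card L = (\<Sum>m\<in>A. card (?c m ` P))" unfolding L_def using finA fin by simp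
  also have "\<dots> \<le> card A * t" using sum_bounded_above[of A "\<lambda>m. card (?c m ` P)" t] t by simp
  finally have cardL: "card L \<le> card A * t" .
  have lineL: "line e \<in> L" if "e \<in> G" for e
    using Gslope[OF that] by (auto simp: L_def line_def consecutive_def)
  have hl: "height_on X Y e x = fst (line e) * x + snd (line e)" if "e \<in> G" for e x
    using height_on_consecutive[of e P X Y "slope X Y e"] Gslope[OF that] by (simp add: line_def)
  have same: "e = e'" if "e \<in> G" "e' \<in> G" "line e = line e'" "spans X e x" "spans X e' x" for e e' x
  proof (rule consecutive_unique[OF inj _ _ that(4,5)])
    show "e \<in> consecutive P X Y (slope X Y e)" using Gslope[OF that(1)] by blast
    have "slope X Y e = slope X Y e'" using that(3) by (simp add: line_def)
    then show "e' \<in> consecutive P X Y (slope X Y e)" using Gslope[OF that(2)] by simp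
    show "height_on X Y e x = height_on X Y e' x" using hl that(1-3) by simp
  qed
  \<comment> \<open>The two lines of a crossing are distinct, so they meet over a single abscissa,
    and over it each line carries at most one edge.\<close>
  have "inj_on (\<lambda>c. (line (fst c), line (snd c))) ?C"
  proof (rule inj_onI)
    fix c c'
    assume c: "c \<in> ?C" "c' \<in> ?C" "(line (fst c), line (snd c)) = (line (fst c'), line (snd c'))"
    obtain e e' g g' where cc: "c = (e, e')" "c' = (g, g')" by (metis prod.exhaust)
    have h: "e \<in> G" "e' \<in> G" "g \<in> G" "g' \<in> G" "e \<noteq> e'" "line e = line g" "line e' = line g'"
      and "crossing X Y e e'" "crossing X Y g g'"
      using c by (simp_all add: cc)
    then obtain x y where x: "spans X e x" "spans X e' x" "height_on X Y e x = height_on X Y e' x"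
       and y: "spans X g y" "spans X g' y" "height_on X Y g y = height_on X Y g' y"
      by (auto simp: crossing_def)
    have ne: "line e \<noteq> line e'" using same h x by blast
    have "fst (line e) * x + snd (line e) = fst (line e') * x + snd (line e')"
      "fst (line e) * y + snd (line e) = fst (line e') * y + snd (line e')"
      using x(3) y(3) h by (simp_all add: hl)
    then have "(fst (line e) - fst (line e')) * (x - y) = 0"
       "fst (line e) = fst (line e') \<Longrightarrow> line e = line e'"
      by (auto simp: algebra_simps prod_eq_iff)
    then have "x = y" using ne by auto
    then have "e = g" "e' = g'" using same h x y by blast+
    then show "c = c'" using cc by simp
  qed
  then have "card ?C \<le> card (L \<times> L)"
    by (rule card_inj_on_le) (use lineL finL in auto)
  then have "card ?C \<le> (card A * t) ^ 2"
    using cardL mult_mono[OF cardL cardL] by (simp add: card_cartesian_product power2_eq_square)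
  then have "real (card ?C) \<le> real ((card A * t) ^ 2)" by (simp only: of_nat_le_iff)
  then have C: "real (card ?C) \<le> (real (card A) * real t) ^ 2" by (simp only: of_nat_mult of_nat_power)
  have "real (card A) * (real (card P) - real t) * real K ^ 2 \<le> real (card G) * real K ^ 2"
    using edges by (rule mult_right_mono) simp
  also have "\<dots> \<le> 3 * real (card P) * real K ^ 3 + real (card ?C)"
    by (rule crossing_inequality[OF gg K])
  finally show ?thesis using C by linarith
qed

lemma few_values_few_slopes:
  fixes X Y :: "'v \<Rightarrow> real"
  assumes fin: "finite P" and inj: "inj_on X P" and finA: "finite A"
    and A: "12 \<le> card A" and t2: "2 * t \<le> card P"
    and t: "\<And>m. m \<in> A \<Longrightarrow> card ((\<lambda>p. Y p - m * X p) ` P) \<le> t"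
  shows "card P * card A \<le> 2304 * t ^ 2"
proof -
  \<comment> \<open>\<open>12 * K \<le> card A\<close> makes the vertex term at most half of the
    edge term. Rounding gives \<open>card A \<le> 24 * K\<close>, and 2304 arises as
    \<open>4 * 24 ^ 2\<close>.\<close>
  define K where "K = card A div 12"
  have K: "12 * K \<le> card A" "card A \<le> 24 * K" "K > 0" using A unfolding K_def by presburger+
  let ?d = "real (card A)" and ?N = "real (card P)" and ?k = "real K" and ?t = "real t"
  have k: "12 * ?k \<le> ?d" "?d \<le> 24 * ?k" "?k > 0" using K by linarith+
  have d: "?d > 0" using A by linarith
  have main: "?d * (?N - ?t) * ?k ^ 2 \<le> 3 * ?N * ?k ^ 3 + (?d * ?t) ^ 2"
    by (rule projection_inequality[OF fin inj finA K(3) t])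
  have "?N / 2 \<le> ?N - ?t" using t2 by linarith
  then have "?d * (?N / 2) * ?k ^ 2 \<le> ?d * (?N - ?t) * ?k ^ 2"
    using d by (intro mult_right_mono mult_left_mono) auto
  moreover have "3 * ?N * ?k ^ 3 \<le> ?d * (?N / 4) * ?k ^ 2"
  proof -
    have "3 * ?N * ?k ^ 3 = (12 * ?k) * (?N / 4 * ?k ^ 2)" by algebra
    also have "\<dots> \<le> ?d * (?N / 4 * ?k ^ 2)" using k(1) by (intro mult_right_mono) auto
    finally show ?thesis by (simp add: mult.assoc)
  qed
  ultimately have "?d * (?N * ?k ^ 2 / 4) \<le> ?d * (?d * ?t ^ 2)"
    using main by (simp add: power_mult_distrib algebra_simps power2_eq_square)
  then have 1: "?N * ?k ^ 2 \<le> 4 * (?d * ?t ^ 2)" using d by simp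
  have "?N * ?d ^ 2 \<le> ?N * (24 * ?k) ^ 2" using k d by (intro mult_left_mono power_mono) auto
  also have "\<dots> = 576 * (?N * ?k ^ 2)" by (simp add: power_mult_distrib)
  also have "\<dots> \<le> ?d * (2304 * ?t ^ 2)" using 1 by simp
  finally have "?d * (?N * ?d) \<le> ?d * (2304 * ?t ^ 2)" by (simp add: power2_eq_square mult_ac)
  then have "?N * ?d \<le> 2304 * ?t ^ 2" using d by simp
  then have "real (card P * card A) \<le> real (2304 * t ^ 2)" by simp
  then show ?thesis by (simp only: of_nat_le_iff)
qed

section \<open>Rich subsets for the dot product\<close>

lemma inner_2: "(u::real^2) \<bullet> v = u $ 1 * v $ 1 + u $ 2 * v $ 2"
  by (simp add: inner_vec_def sum_2)

lemma nonzero_2: "(u::real^2) \<noteq> 0 \<longleftrightarrow> u $ 1 \<noteq> 0 \<or> u $ 2 \<noteq> 0"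
  by (auto simp: vec_eq_iff forall_2)

text \<open>Each pair of distinct points and each nonzero point exclude at most one
  \<open>s\<close>. The shear separates abscissae and makes no level line of a dot product with a
  nonzero \<open>u\<close> in \<open>E\<close> vertical.\<close>

lemma exists_generic_shear:
  fixes E :: "(real^2) set"
  assumes "finite E"
  shows "\<exists>s. inj_on (\<lambda>q. q $ 1 + s * q $ 2) E \<and> (\<forall>u\<in>E. u \<noteq> 0 \<longrightarrow> u $ 2 - s * u $ 1 \<noteq> 0)"
proof -
  define Z where "Z = (\<lambda>(q, q'). (q' $ 1 - q $ 1) / (q $ 2 - q' $ 2)) ` (E \<times> E) \<union> (\<lambda>u. u $ 2 / u $ 1) ` E"
  have "finite Z" using assms by (simp add: Z_def)
  then obtain s where s: "s \<notin> Z" using ex_new_if_finite[OF infinite_UNIV_char_0] by blast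
  have "inj_on (\<lambda>q. q $ 1 + s * q $ 2) E"
  proof (rule inj_onI)
    fix q q' assume h: "q \<in> E" "q' \<in> E" "q $ 1 + s * q $ 2 = q' $ 1 + s * q' $ 2"
    show "q = q'"
    proof (cases "q $ 2 = q' $ 2")
      case True
      then show ?thesis using h(3) by (simp add: vec_eq_iff forall_2)
    next
      case False
      then have "s = (q' $ 1 - q $ 1) / (q $ 2 - q' $ 2)" using h(3) by (simp add: field_simps)
      then have "s \<in> Z" using h(1,2) by (force simp: Z_def)
      then show ?thesis using s by simp
    qed
  qed
  moreover have "u $ 2 - s * u $ 1 \<noteq> 0" if "u \<in> E" "u \<noteq> 0" for u
  proof
    assume h: "u $ 2 - s * u $ 1 = 0"
    then have "u $ 1 \<noteq> 0" using that(2) by (auto simp: nonzero_2)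
    then have "s = u $ 2 / u $ 1" using h by (simp add: field_simps)
    then show False using s that(1) by (auto simp: Z_def)
  qed
  ultimately show ?thesis by blast
qed

text \<open>The difference of two points with equal dot product is both parallel and orthogonal to
  \<open>p\<close>, hence zero.\<close>

lemma inj_on_inner_line:
  fixes u p :: "real^2"
  assumes "u \<noteq> 0" "p \<noteq> 0" "u $ 1 * p $ 2 = u $ 2 * p $ 1"
  shows "inj_on (\<lambda>q. p \<bullet> q) {q. u $ 1 * q $ 2 = u $ 2 * q $ 1}"
proof (rule inj_onI, unfold mem_Collect_eq)
  fix q q' assume h: "u $ 1 * q $ 2 = u $ 2 * q $ 1" "u $ 1 * q' $ 2 = u $ 2 * q' $ 1" "p \<bullet> q = p \<bullet> q'"
  define r where "r = q - q'"
  have r: "u $ 1 * r $ 2 = u $ 2 * r $ 1" "p $ 1 * r $ 1 + p $ 2 * r $ 2 = 0"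
    using h by (simp_all add: r_def inner_2 algebra_simps)
  have "u $ 1 * (p $ 1 * r $ 2 - p $ 2 * r $ 1) = 0" "u $ 2 * (p $ 1 * r $ 2 - p $ 2 * r $ 1) = 0"
    using r(1) assms(3) by algebra+
  then have pr: "p $ 1 * r $ 2 - p $ 2 * r $ 1 = 0" using assms(1) by (auto simp: nonzero_2)
  have "(p $ 1 ^ 2 + p $ 2 ^ 2) * r $ 1 = 0" "(p $ 1 ^ 2 + p $ 2 ^ 2) * r $ 2 = 0"
    using r(2) pr by algebra+
  moreover have "p $ 1 ^ 2 + p $ 2 ^ 2 \<noteq> 0" using assms(2) by (simp add: nonzero_2 sum_power2_eq_zero_iff)
  ultimately have "r $ 1 = 0" "r $ 2 = 0" by (simp_all only: mult_eq_0_iff simp_thms)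
  then have "r = 0" by (simp add: vec_eq_iff forall_2)
  then show "q = q'" by (simp add: r_def)
qed

text \<open>In sheared coordinates the level lines of the dot product with \<open>b\<close> have
  slope \<open>sl b\<close>, and its values are the intercepts up to the factor
  \<open>den b\<close>. Points of equal slope lie on one line through the origin, so
  \<open>B\<close> yields at least \<open>card B / t\<close> slopes when
  \<open>t > 0\<close>.\<close>

lemma few_inner_products:
  fixes B F :: "(real^2) set"
  assumes fin: "finite B" "finite F" and "0 \<notin> B"
    and vals: "\<And>b. b \<in> B \<Longrightarrow> card ((\<lambda>q. b \<bullet> q) ` F) \<le> t"
    and lines: "\<And>b. b \<in> B \<Longrightarrow> card {v\<in>B. b $ 1 * v $ 2 = b $ 2 * v $ 1} \<le> t"
    and "12 * t \<le> card B" "2 * t \<le> card F"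
  shows "card F * card B \<le> 2304 * t ^ 3"
proof -
  obtain s where inj: "inj_on (\<lambda>q. q $ 1 + s * q $ 2) (B \<union> F)"
    and s: "\<And>u. u \<in> B \<union> F \<Longrightarrow> u \<noteq> 0 \<Longrightarrow> u $ 2 - s * u $ 1 \<noteq> 0"
    using exists_generic_shear[of "B \<union> F"] fin by blast
  define X where "X = (\<lambda>q::real^2. q $ 1 + s * q $ 2)"
  define Y where "Y = (\<lambda>q::real^2. q $ 2)"
  define den where "den u = u $ 2 - s * u $ 1" for u :: "real^2"
  define sl where "sl u = - u $ 1 / den u" for u :: "real^2"
  have den: "den b \<noteq> 0" if "b \<in> B" for b using s[of b] that \<open>0 \<notin> B\<close> by (auto simp: den_def)
  have c: "Y q - sl b * X q = (b \<bullet> q) / den b" if "b \<in> B" for b q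
    using den[OF that] by (simp add: sl_def X_def Y_def inner_2 field_simps) (simp add: den_def algebra_simps)
  have vals': "card ((\<lambda>q. Y q - sl b * X q) ` F) \<le> t" if b: "b \<in> B" for b
  proof -
    have "(\<lambda>q. Y q - sl b * X q) ` F = (\<lambda>x. x / den b) ` ((\<lambda>q. b \<bullet> q) ` F)"
      by (simp add: c[OF b] image_image)
    then show ?thesis using card_image_le[of "(\<lambda>q. b \<bullet> q) ` F" "\<lambda>x. x / den b"] vals[OF b] fin by simp
  qed
  have fiber: "card {v\<in>B. sl v = m} \<le> t" if "m \<in> sl ` B" for m
  proof -
    obtain b where b: "b \<in> B" "m = sl b" using \<open>m \<in> sl ` B\<close> by blast
    have "b $ 1 * v $ 2 = b $ 2 * v $ 1" if "v \<in> B" "sl v = sl b" for v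
    proof -
      have "v $ 1 * den b = b $ 1 * den v"
        using that den[OF that(1)] den[OF b(1)] by (simp add: sl_def field_simps)
      then show ?thesis by (simp add: den_def algebra_simps)
    qed
    then have "{v\<in>B. sl v = m} \<subseteq> {v\<in>B. b $ 1 * v $ 2 = b $ 2 * v $ 1}" using b by auto
    then have "card {v\<in>B. sl v = m} \<le> card {v\<in>B. b $ 1 * v $ 2 = b $ 2 * v $ 1}"
      using fin by (intro card_mono) auto
    then show ?thesis using lines[OF b(1)] by simp
  qed
  have "card B = card (\<Union>m\<in>sl ` B. {v\<in>B. sl v = m})" by (rule arg_cong[of _ _ card]) auto
  also have "\<dots> \<le> (\<Sum>m\<in>sl ` B. card {v\<in>B. sl v = m})" using fin by (intro card_UN_le) auto
  also have "\<dots> \<le> card (sl ` B) * t" using sum_bounded_above[of "sl ` B" _ t] fiber by simp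
  finally have cardB: "card B \<le> card (sl ` B) * t" .
  show ?thesis
  proof (cases "t = 0")
    \<comment> \<open>Here \<open>cardB\<close> forces \<open>B\<close> to be empty; otherwise
      \<open>t\<close> can be cancelled.\<close>
    case True
    then show ?thesis using cardB by simp
  next
    case False
    have "12 * t \<le> card (sl ` B) * t" using cardB assms(6) by linarith
    then have "12 \<le> card (sl ` B)" using False by simp
    then have *: "card F * card (sl ` B) \<le> 2304 * t ^ 2"
      using few_values_few_slopes[of F X "sl ` B" t Y] fin inj vals' assms(7)
      by (auto simp: X_def inj_on_Un)
    have "card F * card B \<le> card F * (card (sl ` B) * t)" using cardB by (rule mult_le_mono2)
    also have "\<dots> = (card F * card (sl ` B)) * t" by (simp only: mult.assoc)
    also have "\<dots> \<le> (2304 * t ^ 2) * t" using * by (rule mult_le_mono1)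
    also have "\<dots> = 2304 * t ^ 3" by (simp add: power2_eq_square power3_eq_cube)
    finally show ?thesis .
  qed
qed

text \<open>A removed point has few values on what is left at that moment, hence also on the smaller
  final remainder.\<close>

lemma exhaustive_removal:
  fixes f :: "'a \<Rightarrow> 'a \<Rightarrow> 'b"
  assumes fin: "finite E"
    and bad: "\<And>S. S \<subseteq> E \<Longrightarrow> S \<noteq> {} \<Longrightarrow> \<exists>p\<in>S. card (f p ` S) \<le> t"
  shows "j \<le> card E \<Longrightarrow> \<exists>B\<subseteq>E. card B = j \<and> (\<forall>b\<in>B. card (f b ` (E - B)) \<le> t)"
proof (induction j)
  case 0
  then show ?case by (intro exI[of _ "{}"]) simp
next
  case (Suc j)
  then obtain B where B: "B \<subseteq> E" "card B = j" "\<And>b. b \<in> B \<Longrightarrow> card (f b ` (E - B)) \<le> t" by auto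
  have finB: "finite B" using B(1) fin finite_subset by blast
  have "E - B \<noteq> {}" using B Suc.prems by auto
  then obtain p where p: "p \<in> E - B" "card (f p ` (E - B)) \<le> t" using bad[of "E - B"] by blast
  have "card (f b ` (E - insert p B)) \<le> t" if "b \<in> insert p B" for b
  proof -
    have "card (f b ` (E - insert p B)) \<le> card (f b ` (E - B))"
      using fin by (intro card_mono) auto
    then show ?thesis using that p(2) B(3) by (metis insertE le_trans)
  qed
  then show ?case using B p finB by (intro exI[of _ "insert p B"]) auto
qed

text \<open>If no rich subset exists, lines through the origin carry at most \<open>t\<close>
  points, and half of the points can be removed one by one. Removed and remaining points then
  contradict \<open>few_inner_products\<close>.\<close>

lemma exists_rich_subset:
  fixes E :: "(real^2) set"
  assumes fin: "finite E" and n: "8 \<le> card E" "48 * t \<le> card E" "36864 * t ^ 3 < card E ^ 2"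
  shows "\<exists>S\<subseteq>E. S \<noteq> {} \<and> (\<forall>p\<in>S. t < card ((\<lambda>q. p \<bullet> q) ` S))"
proof (rule ccontr)
  assume neg: "\<not> ?thesis"
  \<comment> \<open>The origin has only the dot product 0 and determines no direction.\<close>
  define E0 where "E0 = E - {0}"
  have finE0: "finite E0" using fin by (simp add: E0_def)
  have cE0: "card E \<le> Suc (card E0)" unfolding E0_def using fin n(1) by (simp add: card_Diff_singleton_if)
  have bad: "\<exists>p\<in>S. card ((\<lambda>q. p \<bullet> q) ` S) \<le> t" if "S \<subseteq> E0" "S \<noteq> {}" for S
    using neg that by (auto simp: E0_def not_less)
  have lines: "card {v\<in>E0. b $ 1 * v $ 2 = b $ 2 * v $ 1} \<le> t" if b: "b \<in> E0" for b
  proof -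
    let ?L = "{v\<in>E0. b $ 1 * v $ 2 = b $ 2 * v $ 1}"
    have "b \<in> ?L" using b by simp
    then obtain p where p: "p \<in> ?L" "card ((\<lambda>q. p \<bullet> q) ` ?L) \<le> t" using bad[of ?L] by blast
    have "inj_on (\<lambda>q. p \<bullet> q) ?L"
      by (rule inj_on_subset[OF inj_on_inner_line[of b p]]) (use b p(1) in \<open>auto simp: E0_def\<close>)
    then show ?thesis using p(2) by (simp add: card_image)
  qed
  have "card E div 2 \<le> card E0" using cE0 n(1) by linarith
  then obtain B where B: "B \<subseteq> E0" "card B = card E div 2"
      "\<And>b. b \<in> B \<Longrightarrow> card ((\<lambda>q. b \<bullet> q) ` (E0 - B)) \<le> t"
    using exhaustive_removal[OF finE0, of "(\<bullet>)" t "card E div 2"] bad by auto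
  have finB: "finite B" using B(1) finE0 finite_subset by blast
  have cF: "card (E0 - B) = card E0 - card B" using B(1) finB by (simp add: card_Diff_subset)
  \<comment> \<open>The factor 4 absorbs rounding and the lost origin; it turns 12 into 48 and 2304
    into \<open>16 * 2304 = 36864\<close>.\<close>
  have 1: "card E \<le> 4 * card B" "card E \<le> 4 * card (E0 - B)" using B(2) cF cE0 n(1) by linarith+
  have "card (E0 - B) * card B \<le> 2304 * t ^ 3"
  proof (rule few_inner_products)
    fix b assume b: "b \<in> B"
    have "card {v\<in>B. b $ 1 * v $ 2 = b $ 2 * v $ 1} \<le> card {v\<in>E0. b $ 1 * v $ 2 = b $ 2 * v $ 1}"
      using B(1) finE0 by (intro card_mono) auto
    then show "card {v\<in>B. b $ 1 * v $ 2 = b $ 2 * v $ 1} \<le> t" using lines[of b] b B(1) by auto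
  qed (use finB finE0 B n(2) 1 in \<open>auto simp: E0_def\<close>)
  moreover have "card E * card E \<le> (4 * card (E0 - B)) * (4 * card B)" using 1 by (intro mult_le_mono)
  ultimately show False using n(3) by (simp add: power2_eq_square)
qed

section \<open>Embedding trees greedily\<close>

lemma walk_leaving_set:
  assumes "graph_walk F p" "hd p \<in> U" "last p \<notin> U"
  shows "\<exists>a b. a \<in> U \<and> b \<notin> U \<and> {a, b} \<in> F"
  using assms
proof (induction p)
  case Nil
  then show ?case by (simp add: graph_walk_def)
next
  case (Cons x p)
  then have "p \<noteq> []" by auto
  then have x: "{x, hd p} \<in> F" "graph_walk F p" "last p \<notin> U"
    using Cons.prems by (auto simp: graph_walk_def successively_Cons)
  show ?case
  proof (cases "hd p \<in> U")
    case True
    then show ?thesis using Cons.IH x by blast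
  next
    case False
    then show ?thesis using x Cons.prems(2) by auto
  qed
qed

text \<open>The paths are simple and stay in \<open>U\<close>, so that a vertex outside
  \<open>U\<close> adjacent to both ends of one with at least two vertices closes a cycle.\<close>

definition path_connected_in :: "'v set set \<Rightarrow> 'v set \<Rightarrow> bool" where
  "path_connected_in F U \<longleftrightarrow> (\<forall>a\<in>U. \<forall>b\<in>U. \<exists>p.
     graph_walk F p \<and> distinct p \<and> set p \<subseteq> U \<and> hd p = a \<and> last p = b)"

lemma path_connected_in_insert:
  assumes pc: "path_connected_in F U" and a: "a \<in> U" "v \<notin> U" "{a, v} \<in> F"
  shows "path_connected_in F (insert v U)"
  unfolding path_connected_in_def
proof (intro ballI)
  fix x y assume xy: "x \<in> insert v U" "y \<in> insert v U"
  show "\<exists>p. graph_walk F p \<and> distinct p \<and> set p \<subseteq> insert v U \<and> hd p = x \<and> last p = y"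
  proof (cases "x = v"; cases "y = v")
    assume "x = v" "y = v"
    then show ?thesis by (intro exI[of _ "[v]"]) (simp add: graph_walk_def)
  next
    assume h: "x = v" "y \<noteq> v"
    then obtain p where p: "graph_walk F p" "distinct p" "set p \<subseteq> U" "hd p = a" "last p = y"
      using pc xy a(1) unfolding path_connected_in_def by blast
    then show ?thesis using h a
      by (intro exI[of _ "v # p"]) (auto simp: graph_walk_def successively_Cons insert_commute)
  next
    assume h: "x \<noteq> v" "y = v"
    then obtain p where p: "graph_walk F p" "distinct p" "set p \<subseteq> U" "hd p = x" "last p = a"
      using pc xy a(1) unfolding path_connected_in_def by blast
    then show ?thesis using h a
      by (intro exI[of _ "p @ [v]"]) (auto simp: graph_walk_def successively_append_iff)
  next
    assume h: "x \<noteq> v" "y \<noteq> v"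
    then obtain p where p: "graph_walk F p" "distinct p" "set p \<subseteq> U" "hd p = x" "last p = y"
      using pc xy unfolding path_connected_in_def by blast
    then show ?thesis by blast
  qed
qed

text \<open>Two attaching edges and a path in \<open>U\<close> between their ends would form a
  cycle; as \<open>a \<noteq> b\<close>, it has at least three vertices.\<close>

lemma unique_attaching_edge:
  assumes tree: "is_tree V F" and pc: "path_connected_in F U"
    and v: "v \<notin> U" "a \<in> U" "{a, v} \<in> F" "b \<in> U" "{b, v} \<in> F"
  shows "a = b"
proof (rule ccontr)
  assume "a \<noteq> b"
  obtain p where p: "graph_walk F p" "distinct p" "set p \<subseteq> U" "hd p = a" "last p = b"
    using pc v unfolding path_connected_in_def by blast
  have "p \<noteq> []" using p(1) by (simp add: graph_walk_def)
  moreover have "length p \<noteq> 1" using p(4,5) \<open>a \<noteq> b\<close> by (auto simp: length_Suc_conv)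
  ultimately have "2 \<le> length p" by (cases p; cases "tl p") auto
  then have "graph_cycle F (v # p)"
    using p v \<open>p \<noteq> []\<close> by (auto simp: graph_cycle_def graph_walk_def successively_Cons insert_commute)
  then show False using tree by (auto simp: is_tree_def)
qed

text \<open>A tree grows from one vertex by attaching leaves. The equation for the edge sets tells
  the induction step that exactly one edge is new.\<close>

lemma tree_growth_induct [consumes 1, case_names vertex attach]:
  assumes tree: "is_tree V F"
    and base: "\<And>u. u \<in> V \<Longrightarrow> P {u}"
    and step: "\<And>U a v. U \<subseteq> V \<Longrightarrow> a \<in> U \<Longrightarrow> v \<in> V - U \<Longrightarrow> {a, v} \<in> F \<Longrightarrow>
      {e\<in>F. e \<subseteq> insert v U} = insert {a, v} {e\<in>F. e \<subseteq> U} \<Longrightarrow> P U \<Longrightarrow> P (insert v U)"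
  shows "P V"
proof -
  have finV: "finite V" and edges: "\<And>e. e \<in> F \<Longrightarrow> e \<subseteq> V \<and> card e = 2"
    using tree by (auto simp: is_tree_def simple_graph_def)
  have conn: "graph_connected V F" using tree by (simp add: is_tree_def)
  then obtain u0 where u0: "u0 \<in> V" by (auto simp: graph_connected_def)
  have grow: "Suc n \<le> card V \<Longrightarrow> \<exists>U\<subseteq>V. U \<noteq> {} \<and> card U = Suc n \<and> path_connected_in F U \<and> P U" for n
  proof (induction n)
    case 0
    have "path_connected_in F {u0}"
      unfolding path_connected_in_def by (auto intro!: exI[of _ "[u0]"] simp: graph_walk_def)
    then show ?case using u0 base by (intro exI[of _ "{u0}"]) auto
  next
    case (Suc n)
    then obtain U where U: "U \<subseteq> V" "U \<noteq> {}" "card U = Suc n" "path_connected_in F U" "P U" by auto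
    have finU: "finite U" using U(1) finV finite_subset by blast
    obtain x where x: "x \<in> U" using U(2) by blast
    have "U \<noteq> V" using U(3) Suc.prems by auto
    then obtain y where y: "y \<in> V" "y \<notin> U" using U(1) by blast
    obtain p where "graph_walk F p" "hd p = x" "last p = y"
      using conn x y U(1) unfolding graph_connected_def by blast
    then obtain a v where av: "a \<in> U" "v \<notin> U" "{a, v} \<in> F" using walk_leaving_set x y by metis
    have vV: "v \<in> V" using edges[OF av(3)] by simp
    have uniq: "e = {a, v}" if e: "e \<in> F" "e \<subseteq> insert v U" "\<not> e \<subseteq> U" for e
    proof -
      obtain b where b: "e = {b, v}" "b \<noteq> v"
        using edges[OF e(1)] e(2,3) by (auto simp: card_2_iff insert_commute)
      then have "b \<in> U" using e(2) by auto
      then show ?thesis using unique_attaching_edge[OF tree U(4) av(2,1,3)] e(1) b by blast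
    qed
    have FU: "{e\<in>F. e \<subseteq> insert v U} = insert {a, v} {e\<in>F. e \<subseteq> U}"
    proof
      show "{e\<in>F. e \<subseteq> insert v U} \<subseteq> insert {a, v} {e\<in>F. e \<subseteq> U}" using uniq by blast
      show "insert {a, v} {e\<in>F. e \<subseteq> U} \<subseteq> {e\<in>F. e \<subseteq> insert v U}" using av by auto
    qed
    have "v \<in> V - U" using vV av(2) by simp
    then have "P (insert v U)" by (rule step[OF U(1) av(1) _ av(3) FU U(5)])
    moreover have "card (insert v U) = Suc (Suc n)" using U(3) finU av(2) by simp
    ultimately show ?case using path_connected_in_insert[OF U(4) av] U(1) vV
      by (intro exI[of _ "insert v U"]) auto
  qed
  have "Suc (card V - 1) = card V" using u0 finV by (cases "card V") auto
  then obtain U where "U \<subseteq> V" "card U = card V" "P U" using grow[of "card V - 1"] by auto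
  then show ?thesis using card_subset_eq[OF finV, of U] by simp
qed

text \<open>Deleting \<open>W\<close> loses at most \<open>m\<close> values; \<open>Q\<close> takes
  one representative for each of \<open>s\<close> remaining values.\<close>

lemma subset_with_distinct_values:
  assumes "finite S" "finite W" "card W \<le> m" "s + m \<le> card (f ` S)"
  shows "\<exists>Q\<subseteq>S - W. card Q = s \<and> inj_on f Q"
proof -
  have "f ` S \<subseteq> f ` (S - W) \<union> f ` W" by blast
  then have "card (f ` S) \<le> card (f ` (S - W) \<union> f ` W)" using assms(1,2) by (intro card_mono) auto
  also have "\<dots> \<le> card (f ` (S - W)) + card (f ` W)" by (rule card_Un_le)
  also have "card (f ` W) \<le> m" using card_image_le[OF assms(2), of f] assms(3) by linarith
  finally have "s \<le> card (f ` (S - W))" using assms(4) by linarith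
  then obtain T where T: "T \<subseteq> f ` (S - W)" "card T = s" by (meson obtain_subset_with_card_n)
  then obtain Q where "Q \<subseteq> S - W" "inj_on f Q" "T = f ` Q" by (meson subset_image_inj)
  then show ?thesis using T(2) card_image by metis
qed

text \<open>\<open>Min\<close> and \<open>Max\<close> select the ends of an edge given as a set; by
  symmetry of the dot product the order does not matter.\<close>

definition edge_weight :: "(nat \<Rightarrow> 'a::real_inner) \<Rightarrow> nat set \<Rightarrow> real" where
  "edge_weight \<phi> e = \<phi> (Min e) \<bullet> \<phi> (Max e)"

lemma edge_weight_pair [simp]: "edge_weight \<phi> {a, b} = \<phi> a \<bullet> \<phi> b"
  by (cases "a \<le> b") (auto simp: edge_weight_def min_def max_def inner_commute)

lemma edge_weight_update:
  assumes "finite e" "e \<noteq> {}" "v \<notin> e"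
  shows "edge_weight (\<phi>(v := q)) e = edge_weight \<phi> e"
proof -
  have "Min e \<noteq> v" "Max e \<noteq> v" using Min_in[OF assms(1,2)] Max_in[OF assms(1,2)] assms(3) by metis+
  then show ?thesis by (simp add: edge_weight_def)
qed

text \<open>Every partial embedding extends by \<open>s\<close> positions of the new leaf that avoid
  the points in use and give its edge different weights. The summand \<open>k\<close> pays for these
  points.\<close>

lemma many_weightings:
  fixes S :: "'a::real_inner set"
  assumes tree: "is_tree V F" and k: "card F = k"
    and S: "finite S" "S \<noteq> {}" and rich: "\<And>p. p \<in> S \<Longrightarrow> s + k \<le> card ((\<lambda>q. p \<bullet> q) ` S)"
  shows "\<exists>\<Phi>. finite \<Phi> \<and> (\<forall>\<phi>\<in>\<Phi>. inj_on \<phi> V \<and> \<phi> ` V \<subseteq> S) \<and> s ^ k \<le> card \<Phi> \<and>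
           inj_on (\<lambda>\<phi>. restrict (edge_weight \<phi>) F) \<Phi>"
proof -
  have finV: "finite V" and edges: "\<And>e. e \<in> F \<Longrightarrow> e \<subseteq> V \<and> card e = 2"
    using tree by (auto simp: is_tree_def simple_graph_def)
  have finF: "finite F" using edges finV by (meson PowI finite_Pow_iff finite_subset subsetI)
  define D where "D U = {e\<in>F. e \<subseteq> U}" for U
  \<comment> \<open>The vertex count is carried along because it bounds the points in use by
    \<open>k\<close> before each attachment.\<close>
  have main: "card V = Suc (card (D V)) \<and> (\<exists>\<Phi>. finite \<Phi> \<and> (\<forall>\<phi>\<in>\<Phi>. inj_on \<phi> V \<and> \<phi> ` V \<subseteq> S) \<and>
      s ^ card (D V) \<le> card \<Phi> \<and> inj_on (\<lambda>\<phi>. restrict (edge_weight \<phi>) (D V)) \<Phi>)"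
    using tree
  proof (induction rule: tree_growth_induct)
    case (vertex u)
    have D: "D {u} = {}"
    proof -
      have "\<not> e \<subseteq> {u}" if "e \<in> F" for e
        using edges[OF that] card_mono[of "{u}" e] by auto
      then show ?thesis by (auto simp: D_def)
    qed
    obtain p where "p \<in> S" using S(2) by blast
    then show ?case by (intro conjI exI[of _ "{\<lambda>_. p}"]) (auto simp: D)
  next
    case (attach U a v)
    have DU: "D (insert v U) = insert {a, v} (D U)" using attach(5) by (simp add: D_def)
    have new: "{a, v} \<notin> D U" using attach(3) by (auto simp: D_def)
    have finD: "finite (D U)" using finF by (simp add: D_def)
    have finU: "finite U" using attach(1) finV finite_subset by blast
    have cD: "card (D (insert v U)) = Suc (card (D U))" using new finD by (simp add: DU)
    have cU: "card U = Suc (card (D U))" using attach(6) by blast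
    obtain \<Phi> where \<Phi>: "finite \<Phi>" "\<And>\<phi>. \<phi> \<in> \<Phi> \<Longrightarrow> inj_on \<phi> U \<and> \<phi> ` U \<subseteq> S"
       "s ^ card (D U) \<le> card \<Phi>" "inj_on (\<lambda>\<phi>. restrict (edge_weight \<phi>) (D U)) \<Phi>"
      using attach(6) by blast
    have "card (D (insert v U)) \<le> k" unfolding k[symmetric] using finF by (intro card_mono) (auto simp: D_def)
    then have Uk: "card U \<le> k" using cD cU by simp
    have "\<exists>Q\<subseteq>S - \<phi> ` U. card Q = s \<and> inj_on (\<lambda>q. \<phi> a \<bullet> q) Q" if "\<phi> \<in> \<Phi>" for \<phi>
    proof (rule subset_with_distinct_values[where m = k])
      show "card (\<phi> ` U) \<le> k" using card_image_le[OF finU, of \<phi>] Uk by linarith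
      show "s + k \<le> card ((\<lambda>q. \<phi> a \<bullet> q) ` S)" using rich \<Phi>(2)[OF that] attach(2) by blast
    qed (use S finU in auto)
    then obtain Q where Q: "\<And>\<phi>. \<phi> \<in> \<Phi> \<Longrightarrow> Q \<phi> \<subseteq> S - \<phi> ` U"
        "\<And>\<phi>. \<phi> \<in> \<Phi> \<Longrightarrow> card (Q \<phi>) = s" "\<And>\<phi>. \<phi> \<in> \<Phi> \<Longrightarrow> inj_on (\<lambda>q. \<phi> a \<bullet> q) (Q \<phi>)"
      by metis
    have finQ: "finite (Q \<phi>)" if "\<phi> \<in> \<Phi>" for \<phi> using Q(1)[OF that] S(1) by (meson finite_Diff finite_subset)
    define g where "g = (\<lambda>(\<phi>, q). \<phi>(v := q) :: nat \<Rightarrow> 'a)"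
    let ?W = "\<lambda>\<phi>. restrict (edge_weight \<phi>) (D (insert v U))"
    \<comment> \<open>Old edges recover the old embedding, the new edge recovers \<open>q\<close>.
      Injectivity of the composition counts the extended maps and also separates them by
      weights.\<close>
    have inj: "inj_on (?W \<circ> g) (Sigma \<Phi> Q)"
    proof (rule inj_onI, clarify)
      fix \<phi> q \<phi>' q'
      assume h: "\<phi> \<in> \<Phi>" "q \<in> Q \<phi>" "\<phi>' \<in> \<Phi>" "q' \<in> Q \<phi>'" "(?W \<circ> g) (\<phi>, q) = (?W \<circ> g) (\<phi>', q')"
      have eq: "edge_weight (\<phi>(v := q)) e = edge_weight (\<phi>'(v := q')) e" if "e \<in> D (insert v U)" for e
        using fun_cong[OF h(5), of e] that by (simp add: g_def)
      have "edge_weight \<phi> e = edge_weight \<phi>' e" if e: "e \<in> D U" for e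
      proof -
        have "finite e" "e \<noteq> {}" "v \<notin> e"
          using e edges[of e] attach(3) by (auto simp: D_def intro: card_ge_0_finite)
        then show ?thesis using eq[of e] e by (simp add: DU edge_weight_update)
      qed
      then have "restrict (edge_weight \<phi>) (D U) = restrict (edge_weight \<phi>') (D U)"
        by (auto simp: restrict_def)
      then have \<phi>: "\<phi> = \<phi>'" using inj_onD[OF \<Phi>(4)] h(1,3) by blast
      have "a \<noteq> v" using attach(2,3) by auto
      then have "\<phi> a \<bullet> q = \<phi> a \<bullet> q'" using eq[of "{a, v}"] \<phi> by (simp add: DU)
      then have "q = q'" using inj_onD[OF Q(3)[OF h(1)]] h(2,4) \<phi> by blast
      then show "\<phi> = \<phi>' \<and> q = q'" using \<phi> by simp
    qed
    have injg: "inj_on g (Sigma \<Phi> Q)" using inj by (rule inj_on_imageI2)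
    have injW: "inj_on ?W (g ` Sigma \<Phi> Q)" using inj by (rule inj_on_imageI)
    have "card (g ` Sigma \<Phi> Q) = (\<Sum>\<phi>\<in>\<Phi>. card (Q \<phi>))"
      using \<Phi>(1) finQ by (simp add: card_image[OF injg] card_SigmaI)
    also have "\<dots> = card \<Phi> * s" using Q(2) by simp
    finally have large: "s ^ card (D (insert v U)) \<le> card (g ` Sigma \<Phi> Q)" using \<Phi>(3) by (simp add: cD mult.commute)
    have fing: "finite (g ` Sigma \<Phi> Q)" using \<Phi>(1) finQ by auto
    have emb: "\<forall>\<psi>\<in>g ` Sigma \<Phi> Q. inj_on \<psi> (insert v U) \<and> \<psi> ` insert v U \<subseteq> S"
    proof
      fix \<psi> assume \<psi>: "\<psi> \<in> g ` Sigma \<Phi> Q"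
      obtain \<phi> q where h: "\<phi> \<in> \<Phi>" "q \<in> Q \<phi>" "\<psi> = \<phi>(v := q)" using \<psi> by (auto simp: g_def)
      then have "q \<in> S - \<phi> ` U" using Q(1) by blast
      then show "inj_on \<psi> (insert v U) \<and> \<psi> ` insert v U \<subseteq> S" using \<Phi>(2)[OF h(1)] attach(3) h(3)
        by (auto simp: inj_on_fun_updI fun_upd_image inj_on_def)
    qed
    have "card (insert v U) = Suc (card (D (insert v U)))"
      using cU cD finU attach(3) by simp
    then show ?case by (intro conjI exI[of _ "g ` Sigma \<Phi> Q"] large fing emb injW)
  qed
  have DV: "D V = F" using edges by (auto simp: D_def)
  show ?thesis using main unfolding DV k by (rule conjunct2)
qed

text \<open>Lower bounds on \<open>card\<close> need this, since an infinite set has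
  \<open>card\<close> 0. All weights are dot products of points of \<open>E\<close>.\<close>

lemma finite_realized:
  assumes "finite E" "\<And>e. e \<in> set es \<Longrightarrow> e \<subseteq> V \<and> card e = 2"
  shows "finite {w. realized V es w E}"
proof (rule finite_subset)
  show "{w. realized V es w E} \<subseteq> {w. set w \<subseteq> (\<lambda>(x, y). x \<bullet> y) ` (E \<times> E) \<and> length w = length es}"
  proof (clarify, intro conjI subsetI)
    fix w assume "realized V es w E"
    then obtain \<phi> where len: "length w = length es" and \<phi>: "\<phi> ` V \<subseteq> E"
       "\<And>j a b. j < length es \<Longrightarrow> es ! j = {a, b} \<Longrightarrow> \<phi> a \<bullet> \<phi> b = w ! j"
      by (auto simp: realized_def)
    show "length w = length es" by (rule len)
    fix x assume "x \<in> set w"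
    then obtain j where j: "j < length es" "x = w ! j" using len by (auto simp: in_set_conv_nth)
    have "es ! j \<subseteq> V \<and> card (es ! j) = 2" using assms(2) j(1) by simp
    then obtain a b where ab: "es ! j = {a, b}" "a \<in> V" "b \<in> V" by (auto simp: card_2_iff)
    have "x = \<phi> a \<bullet> \<phi> b" using \<phi>(2)[OF j(1) ab(1)] j(2) by simp
    then show "x \<in> (\<lambda>(x, y). x \<bullet> y) ` (E \<times> E)" using \<phi>(1) ab(2,3) by auto
  qed
  show "finite {w. set w \<subseteq> (\<lambda>(x, y). x \<bullet> y) ` (E \<times> E) \<and> length w = length es}"
    by (rule finite_lists_length_eq) (use assms(1) in auto)
qed

lemma card_realized_ge:
  fixes S E :: "'a::real_inner set" and V :: "nat set"
  assumes tree: "is_tree V (set es)" and es: "distinct es" "length es = k"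
    and S: "S \<subseteq> E" "finite E" "S \<noteq> {}"
    and rich: "\<And>p. p \<in> S \<Longrightarrow> s + k \<le> card ((\<lambda>q. p \<bullet> q) ` S)"
  shows "s ^ k \<le> card {w. realized V es w E}"
proof -
  have edges: "\<And>e. e \<in> set es \<Longrightarrow> e \<subseteq> V \<and> card e = 2"
    using tree by (auto simp: is_tree_def simple_graph_def)
  have "card (set es) = k" using es by (simp add: distinct_card)
  then obtain \<Phi> where \<Phi>: "finite \<Phi>" "\<And>\<phi>. \<phi> \<in> \<Phi> \<Longrightarrow> inj_on \<phi> V \<and> \<phi> ` V \<subseteq> S" "s ^ k \<le> card \<Phi>"
       "inj_on (\<lambda>\<phi>. restrict (edge_weight \<phi>) (set es)) \<Phi>"
    using many_weightings[OF tree _ finite_subset[OF S(1,2)] S(3) rich] by blast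
  let ?w = "\<lambda>\<phi>. map (edge_weight \<phi>) es"
  have "inj_on ?w \<Phi>"
  proof (rule inj_onI)
    fix \<phi> \<phi>' assume h: "\<phi> \<in> \<Phi>" "\<phi>' \<in> \<Phi>" "?w \<phi> = ?w \<phi>'"
    then have "restrict (edge_weight \<phi>) (set es) = restrict (edge_weight \<phi>') (set es)"
      by (auto simp: restrict_def)
    then show "\<phi> = \<phi>'" using inj_onD[OF \<Phi>(4)] h(1,2) by blast
  qed
  then have "card \<Phi> \<le> card {w. realized V es w E}"
  proof (rule card_inj_on_le)
    show "?w ` \<Phi> \<subseteq> {w. realized V es w E}"
    proof (clarify)
      fix \<phi> assume "\<phi> \<in> \<Phi>"
      then have "inj_on \<phi> V" "\<phi> ` V \<subseteq> E" using \<Phi>(2) S(1) by blast+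
      then show "realized V es (?w \<phi>) E"
        unfolding realized_def by (intro conjI exI[of _ \<phi>]) auto
    qed
  qed (rule finite_realized[OF S(2) edges])
  then show ?thesis using \<Phi>(3) by linarith
qed

theorem theorem1p1:
  fixes k :: nat
  assumes "k \<ge> 1"
  shows "\<exists>c::real. c > 0 \<and> (\<exists>N::nat.
           \<forall>(V::nat set) (es::nat set list).
             is_tree V (set es) \<and> distinct es \<and> length es = k \<longrightarrow>
             (\<forall>E::(real^2) set. finite E \<and> card E \<ge> N \<longrightarrow>
                real (card {w. realized V es w E})
                  \<ge> c * real (card E) powr (2 * real k / 3)))"
proof (intro exI conjI allI impI)
  \<comment> \<open>With \<open>x\<close> the cube root of \<open>n\<close>, about
    \<open>x ^ 2 / 40\<close> values are available at each vertex and at most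
    \<open>x ^ 2 / 80\<close> are lost to points in use.\<close>
  show "(1 / 80 :: real) ^ k > 0" by simp
  fix V :: "nat set" and es and E :: "(real^2) set"
  assume tree: "is_tree V (set es) \<and> distinct es \<and> length es = k"
    and E: "finite E \<and> card E \<ge> (80 * k) ^ 3 + 8"
  define n where "n = card E"
  define x where "x = real n powr (1 / 3)"
  have n: "n \<ge> (80 * k) ^ 3 + 8" using E by (simp add: n_def)
  then have npos: "real n > 0" by linarith
  have xpos: "x > 0" using npos by (simp add: x_def)
  have x3: "x ^ 3 = real n"
    using npos powr_realpow[OF xpos, of 3] by (simp add: x_def powr_powr)
  have "real ((80 * k) ^ 3 + 8) \<le> x ^ 3" unfolding x3 using n by (simp only: of_nat_le_iff)
  then have "(80 * real k) ^ 3 + 2 ^ 3 \<le> x ^ 3" by simp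
  moreover have "0 \<le> (80 * real k) ^ 3" by simp
  moreover have "0 \<le> (2 :: real) ^ 3" by simp
  ultimately have "(80 * real k) ^ 3 \<le> x ^ 3" "2 ^ 3 \<le> x ^ 3" by linarith+
  then have x: "80 * real k \<le> x" "2 \<le> x"
    using power_mono_iff[of "80 * real k" x 3] power_mono_iff[of 2 x 3] xpos by auto
  \<comment> \<open>The divisor 40 satisfies \<open>36864 < 40 ^ 3\<close>; together with
    \<open>2 \<le> x\<close> it also gives \<open>48 * t \<le> n\<close>.\<close>
  define t where "t = nat \<lfloor>x ^ 2 / 40\<rfloor>"
  have t: "real t \<le> x ^ 2 / 40" "x ^ 2 / 40 < real t + 1" unfolding t_def by auto linarith
  have "48 * real t \<le> 2 * x ^ 2" using t(1) by linarith
  also have "\<dots> \<le> x * x ^ 2" using x(2) by (intro mult_right_mono) auto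
  also have "\<dots> = real n" using x3 by (simp add: power2_eq_square power3_eq_cube)
  finally have t48: "48 * t \<le> card E" unfolding n_def by linarith
  have "36864 * real t ^ 3 \<le> 36864 * (x ^ 2 / 40) ^ 3"
    using t(1) by (intro mult_left_mono power_mono) auto
  also have "\<dots> = 36864 / 64000 * (x ^ 3) ^ 2" by (simp add: power_divide flip: power_mult)
  also have "\<dots> < real n ^ 2" unfolding x3 using npos by simp
  finally have "real (36864 * t ^ 3) < real (n ^ 2)" by simp
  then have tn: "36864 * t ^ 3 < card E ^ 2" unfolding n_def by (simp only: of_nat_less_iff)
  have n8: "8 \<le> card E" using n by (simp add: n_def)
  obtain S where S: "S \<subseteq> E" "S \<noteq> {}" "\<And>p. p \<in> S \<Longrightarrow> t < card ((\<lambda>q. p \<bullet> q) ` S)"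
    using exists_rich_subset[OF _ n8 t48 tn] E by blast
  have "80 * real k \<le> x ^ 2" using mult_mono[of 1 x "80 * real k" x] x by (simp add: power2_eq_square)
  then have k: "real k \<le> x ^ 2 / 80" by simp
  then have kt: "k \<le> t + 1" using t(2) zero_le_power2[of x] by linarith
  \<comment> \<open>More than \<open>t\<close> values means at least \<open>t + 1\<close>, and the
    extra 1 compensates for the floor in \<open>t\<close>.\<close>
  define s where "s = t + 1 - k"
  have "s ^ k \<le> card {w. realized V es w E}"
  proof (rule card_realized_ge[of V es k S E s])
    show "s + k \<le> card ((\<lambda>q. p \<bullet> q) ` S)" if "p \<in> S" for p
      using S(3)[OF that] kt by (simp add: s_def)
  qed (use tree E S in auto)
  then have "real (s ^ k) \<le> real (card {w. realized V es w E})" by (simp only: of_nat_le_iff)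
  moreover have "(x ^ 2 / 80) ^ k \<le> real (s ^ k)"
  proof -
    have "x ^ 2 / 80 \<le> real s" using k kt t(2) by (simp add: s_def of_nat_diff)
    then show ?thesis by (simp add: power_mono)
  qed
  moreover have "(1 / 80) ^ k * real (card E) powr (2 * real k / 3) = (x ^ 2 / 80) ^ k"
  proof -
    have "x ^ 2 = real n powr (2 / 3)"
      using npos powr_realpow[OF xpos, of 2] by (simp add: x_def powr_powr)
    then have "(x ^ 2) ^ k = real n powr (2 * real k / 3)"
      using npos powr_realpow[of "real n powr (2 / 3)" k] by (simp add: powr_powr mult.commute)
    then show ?thesis by (simp add: n_def power_divide)
  qed
  ultimately show "(1 / 80) ^ k * real (card E) powr (2 * real k / 3)
      \<le> real (card {w. realized V es w E})" by linarith
qed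

end
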